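(* Let $X$ be a non-negative random variable with probability density function $f$. Assume that $f$ is complex analytic at every point $x$ of $[0,\infty)$ and that $f(0)>0$. Let $n$ and $s$ be fixed integers with $1\le s\le n-1$, and let $X_1,\dots,X_n$ be independent random variables, each distributed as $X$. If $$\max(X_1,\dots,X_{n-s})+\frac{1}{n-s+1}X_{n-s+1}+\frac{1}{n-s+2}X_{n-s+2}+\cdots+\frac{1}{n}X_n\ \stackrel{d}{=}\ \max(X_1,\dots,X_n),$$ then $X$ is exponentially distributed with some positive parameter, i.e. there is $\lambda>0$ such that $f(x)=\lambda e^{-\lambda x}$ for all $x\ge 0$.
   Context: The symbol $\stackrel{d}{=}$ denotes equality in distribution. "$f$ is complex analytic at every point of $[0,\infty)$" means that the restriction of $f$ to $[0,\infty)$ extends to a complex analytic function on some open subset of $\mathbb{C}$ containing $[0,\infty)$; in particular $f$ is infinitely differentiable on $[0,\infty)$ (one-sided derivatives at $0$) and has a power series expansion about each point of $[0,\infty)$. The density $f$ is taken to vanish on $(-\infty,0)$, and the cumulative distribution function of $X$ is absolutely continuous with value $0$ at $0$. *)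

theory Defs
  imports "HOL-Probability.Probability" "HOL-Complex_Analysis.Complex_Analysis"
begin

definition complex_analytic_on_nonneg :: "(real \<Rightarrow> real) \<Rightarrow> bool" where
  "complex_analytic_on_nonneg f \<longleftrightarrow>
     (\<exists>U F. open U \<and> complex_of_real ` {0..} \<subseteq> U \<and> F holomorphic_on U \<and>
        (\<forall>x\<ge>0. F (complex_of_real x) = complex_of_real (f x)))"

text \<open>
  Equality in distribution of real random variables, possibly living on different spaces.
  Measurability is part of the definition because \<open>distr\<close> is only meaningful for
  measurable functions.
\<close>

definition eq_in_distribution ::
    "'a measure \<Rightarrow> ('a \<Rightarrow> real) \<Rightarrow> 'b measure \<Rightarrow> ('b \<Rightarrow> real) \<Rightarrow> bool" where
  "eq_in_distribution M X N Y \<longleftrightarrow>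
     X \<in> borel_measurable M \<and> Y \<in> borel_measurable N \<and> distr M borel X = distr N borel Y"

end

theory Submission
  imports Defs "HOL-Real_Asymp.Real_Asymp"
begin

text \<open>
  Let \<open>\<Phi>\<close> be the distribution function of \<open>X\<close>, \<open>m = n - s\<close>, and let \<open>L j t\<close> be the Laplace transform of \<open>\<Phi> ^ j\<close>,
  so that \<open>t * L j t\<close> is the expectation of \<open>exp (- t * max)\<close> over \<open>j\<close> copies. The hypothesis becomes
  \<open>L n t = L m t * (\<Prod>i=m+1..n. (t / i) * L 1 (t / i))\<close>. Put \<open>a = f 0\<close> and \<open>\<mu> = f' 0 / a\<close>. The solution \<open>H\<close> of
  \<open>H' = a + \<mu> * H\<close>, \<open>H 0 = 0\<close>, whose derivative is \<open>a * exp (\<mu> * x)\<close>, satisfies the same equation exactly for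
  large \<open>t\<close>. If \<open>f x - a * exp (\<mu> * x)\<close> had a first nonzero Taylor term \<open>c * x ^ k\<close>, then \<open>k \<ge> 2\<close>, and comparing
  the terms of relative order \<open>k\<close> in \<open>1 / t\<close> in both equations (Watson's lemma) would give
  \<open>c * (k + n choose k + 1) = c * ((k + m choose k + 1) + (\<Sum>i=m+1..n. i ^ k))\<close>. Since \<open>(k + i - 1 choose k) < i ^ k\<close>
  for \<open>i, k \<ge> 2\<close>, this forces \<open>c = 0\<close>. So \<open>f x = a * exp (\<mu> * x)\<close>, and total mass 1 gives \<open>\<mu> = - a\<close>.
\<close>

section \<open>Functions of controlled growth and their Laplace transforms\<close>

text \<open>One bound controls both ends: vanishing to order \<open>p\<close> at \<open>0\<close>,
  and at most exponential growth. The Laplace transform then exists for large \<open>t\<close> and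
  has size at most of order \<open>1 / t ^ Suc p\<close>.\<close>

definition exp_O :: "nat \<Rightarrow> (real \<Rightarrow> real) set" where
  "exp_O p = {u \<in> borel_measurable borel.
     \<exists>C B. \<forall>x\<ge>0. \<bar>u x\<bar> \<le> C * x ^ p * exp (B * x)}"

lemma exp_O_I:
  assumes "u \<in> borel_measurable borel" "\<And>x. 0 \<le> x \<Longrightarrow> \<bar>u x\<bar> \<le> C * x ^ p * exp (B * x)"
  shows "u \<in> exp_O p"
  using assms unfolding exp_O_def by blast

lemma exp_O_measurable [measurable_dest]: "u \<in> exp_O p \<Longrightarrow> u \<in> borel_measurable borel"
  by (simp add: exp_O_def)

lemma exp_O_E:
  assumes "u \<in> exp_O p"
  obtains C B where "0 \<le> C" "0 \<le> B" "\<And>x. 0 \<le> x \<Longrightarrow> \<bar>u x\<bar> \<le> C * x ^ p * exp (B * x)"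
proof -
  from assms obtain C B where CB: "\<And>x. 0 \<le> x \<Longrightarrow> \<bar>u x\<bar> \<le> C * x ^ p * exp (B * x)"
    unfolding exp_O_def by blast
  have "\<bar>u x\<bar> \<le> \<bar>C\<bar> * x ^ p * exp (\<bar>B\<bar> * x)" if "0 \<le> x" for x
  proof -
    have "\<bar>u x\<bar> \<le> C * x ^ p * exp (B * x)" by (rule CB[OF that])
    also have "\<dots> \<le> \<bar>C\<bar> * x ^ p * exp (\<bar>B\<bar> * x)"
      using that by (intro mult_mono) (auto intro: mult_right_mono)
    finally show ?thesis .
  qed
  then show thesis using that[of "\<bar>C\<bar>" "\<bar>B\<bar>"] by auto
qed

lemma exp_O_add:
  assumes "u \<in> exp_O p" "v \<in> exp_O p"
  shows "(\<lambda>x. u x + v x) \<in> exp_O p"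
proof -
  obtain C B where 1: "0 \<le> C" "0 \<le> B" "\<And>x. 0 \<le> x \<Longrightarrow> \<bar>u x\<bar> \<le> C * x ^ p * exp (B * x)"
    using exp_O_E[OF assms(1)] by blast
  obtain C' B' where 2: "0 \<le> C'" "0 \<le> B'" "\<And>x. 0 \<le> x \<Longrightarrow> \<bar>v x\<bar> \<le> C' * x ^ p * exp (B' * x)"
    using exp_O_E[OF assms(2)] by blast
  show ?thesis
  proof (rule exp_O_I[where C = "C + C'" and B = "B + B'"])
    show "(\<lambda>x. u x + v x) \<in> borel_measurable borel"
      using assms by (auto dest!: exp_O_measurable)
    fix x :: real assume x: "0 \<le> x"
    have "\<bar>u x\<bar> \<le> C * x ^ p * exp ((B + B') * x)"
      using 1(3)[OF x] by (rule order_trans) (use x 1 2 in \<open>auto intro!: mult_left_mono mult_right_mono\<close>)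
    moreover have "\<bar>v x\<bar> \<le> C' * x ^ p * exp ((B + B') * x)"
      using 2(3)[OF x] by (rule order_trans) (use x 1 2 in \<open>auto intro!: mult_left_mono mult_right_mono\<close>)
    ultimately show "\<bar>u x + v x\<bar> \<le> (C + C') * x ^ p * exp ((B + B') * x)"
      by (simp add: distrib_right)
  qed
qed

lemma exp_O_mult:
  assumes "u \<in> exp_O p" "v \<in> exp_O q"
  shows "(\<lambda>x. u x * v x) \<in> exp_O (p + q)"
proof -
  obtain C B where 1: "0 \<le> C" "0 \<le> B" "\<And>x. 0 \<le> x \<Longrightarrow> \<bar>u x\<bar> \<le> C * x ^ p * exp (B * x)"
    using exp_O_E[OF assms(1)] by blast
  obtain C' B' where 2: "0 \<le> C'" "0 \<le> B'" "\<And>x. 0 \<le> x \<Longrightarrow> \<bar>v x\<bar> \<le> C' * x ^ q * exp (B' * x)"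
    using exp_O_E[OF assms(2)] by blast
  show ?thesis
  proof (rule exp_O_I[where C = "C * C'" and B = "B + B'"])
    show "(\<lambda>x. u x * v x) \<in> borel_measurable borel"
      using assms by (auto dest!: exp_O_measurable)
    fix x :: real assume x: "0 \<le> x"
    have "\<bar>u x\<bar> * \<bar>v x\<bar> \<le> (C * x ^ p * exp (B * x)) * (C' * x ^ q * exp (B' * x))"
      using 1 2 x by (intro mult_mono) auto
    then show "\<bar>u x * v x\<bar> \<le> C * C' * x ^ (p + q) * exp ((B + B') * x)"
      by (simp only: abs_mult power_add distrib_right exp_add) (simp add: mult_ac)
  qed
qed

lemma exp_O_monom: "(\<lambda>x. c * x ^ p) \<in> exp_O p"
  by (rule exp_O_I[where C = "\<bar>c\<bar>" and B = 0]) (auto simp: abs_mult)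

lemma exp_O_cmult: "u \<in> exp_O p \<Longrightarrow> (\<lambda>x. c * u x) \<in> exp_O p"
  using exp_O_mult[OF exp_O_monom[of c 0]] by simp

text \<open>The surplus factor \<open>x ^ (p - q)\<close> is absorbed into the exponential because
  \<open>x \<le> exp x\<close>.\<close>

lemma exp_O_mono:
  assumes "u \<in> exp_O p" "q \<le> p"
  shows "u \<in> exp_O q"
proof -
  obtain C B where 1: "0 \<le> C" "0 \<le> B" "\<And>x. 0 \<le> x \<Longrightarrow> \<bar>u x\<bar> \<le> C * x ^ p * exp (B * x)"
    using exp_O_E[OF assms(1)] by blast
  show ?thesis
  proof (rule exp_O_I[where C = C and B = "real (p - q) + B"])
    show "u \<in> borel_measurable borel" using assms by (auto dest!: exp_O_measurable)
    fix x :: real assume x: "0 \<le> x"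
    have "x \<le> exp x" using exp_ge_add_one_self[of x] by linarith
    then have "x ^ (p - q) \<le> exp (real (p - q) * x)"
      using x by (simp add: exp_of_nat_mult power_mono)
    moreover have "x ^ p = x ^ q * x ^ (p - q)"
      using assms(2) by (simp flip: power_add)
    ultimately have "C * x ^ p * exp (B * x) \<le> C * (x ^ q * exp (real (p - q) * x)) * exp (B * x)"
      using 1 x by (auto intro!: mult_left_mono mult_right_mono)
    also have "\<dots> = C * x ^ q * exp ((real (p - q) + B) * x)"
      by (simp only: exp_add distrib_right mult.assoc)
    finally show "\<bar>u x\<bar> \<le> C * x ^ q * exp ((real (p - q) + B) * x)"
      using 1(3)[OF x] by linarith
  qed
qed

text \<open>Order of vanishing is a local matter: beyond \<open>d\<close> the factor
  \<open>x ^ p\<close> is at least \<open>d ^ p\<close>, so an exponential bound survives after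
  division by \<open>d ^ p\<close>. Taylor estimates hold only near \<open>0\<close>, hence this
  upgrade.\<close>

lemma exp_O_of_local:
  assumes u: "u \<in> exp_O 0" and d: "0 < d"
    and loc: "\<And>x. 0 \<le> x \<Longrightarrow> x \<le> d \<Longrightarrow> \<bar>u x\<bar> \<le> K * x ^ p"
  shows "u \<in> exp_O p"
proof -
  obtain C B where 1: "0 \<le> C" "0 \<le> B" "\<And>x. 0 \<le> x \<Longrightarrow> \<bar>u x\<bar> \<le> C * x ^ 0 * exp (B * x)"
    using exp_O_E[OF u] by blast
  show ?thesis
  proof (rule exp_O_I[where C = "\<bar>K\<bar> + C / d ^ p" and B = B])
    show "u \<in> borel_measurable borel" using u by (rule exp_O_measurable)
    fix x :: real assume x: "0 \<le> x"
    have e1: "0 \<le> C / d ^ p" using 1 d by auto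
    show "\<bar>u x\<bar> \<le> (\<bar>K\<bar> + C / d ^ p) * x ^ p * exp (B * x)"
    proof (cases "x \<le> d")
      case True
      have "\<bar>u x\<bar> \<le> K * x ^ p * 1" using loc[OF x True] by simp
      also have "\<dots> \<le> (\<bar>K\<bar> + C / d ^ p) * x ^ p * exp (B * x)"
        using x 1 e1 by (intro mult_mono) (auto intro!: mult_right_mono)
      finally show ?thesis .
    next
      case False
      have "d ^ p \<le> x ^ p" using False d by (intro power_mono) auto
      then have "C \<le> C / d ^ p * x ^ p"
        using d 1 by (simp add: field_simps mult_left_mono)
      also have "\<dots> \<le> (\<bar>K\<bar> + C / d ^ p) * x ^ p"
        using x by (intro mult_right_mono) auto
      finally have "C * exp (B * x) \<le> (\<bar>K\<bar> + C / d ^ p) * x ^ p * exp (B * x)"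
        by (intro mult_right_mono) auto
      then show ?thesis using 1(3)[OF x] by (simp only: power_0 mult_1_right)
    qed
  qed
qed

text \<open>The coefficient \<open>a\<close> may be \<open>0\<close>: what is fixed is the Taylor
  term of order \<open>p\<close>, not the exact order of vanishing.\<close>

definition lead :: "nat \<Rightarrow> real \<Rightarrow> (real \<Rightarrow> real) \<Rightarrow> bool" where
  "lead p a u \<longleftrightarrow> (\<lambda>x. u x - a * x ^ p) \<in> exp_O (Suc p)"

lemma lead_imp_exp_O:
  assumes "lead p a u"
  shows "u \<in> exp_O p"
proof -
  have "(\<lambda>x. (u x - a * x ^ p) + a * x ^ p) \<in> exp_O p"
    using assms unfolding lead_def
    by (intro exp_O_add exp_O_monom) (auto elim: exp_O_mono)
  then show ?thesis by simp
qed

lemma lead_add: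
  assumes "lead p a u" "lead p b v"
  shows "lead p (a + b) (\<lambda>x. u x + v x)"
  using exp_O_add[OF assms[unfolded lead_def]] by (simp add: lead_def algebra_simps)

text \<open>The error splits as
  \<open>(u x - a * x ^ p) * v x + a * x ^ p * (v x - b * x ^ q)\<close>, and each summand is one
  order better than the product.\<close>

lemma lead_mult:
  assumes "lead p a u" "lead q b v"
  shows "lead (p + q) (a * b) (\<lambda>x. u x * v x)"
proof -
  have "(\<lambda>x. (u x - a * x ^ p) * v x) \<in> exp_O (Suc p + q)"
    using assms lead_imp_exp_O by (intro exp_O_mult) (auto simp: lead_def)
  moreover have "(\<lambda>x. a * x ^ p * (v x - b * x ^ q)) \<in> exp_O (p + Suc q)"
    using assms by (intro exp_O_mult exp_O_monom) (auto simp: lead_def)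
  ultimately have "(\<lambda>x. (u x - a * x ^ p) * v x + a * x ^ p * (v x - b * x ^ q)) \<in> exp_O (Suc (p + q))"
    by (intro exp_O_add) simp_all
  then show ?thesis by (simp add: lead_def algebra_simps power_add)
qed

lemma lead_zero: "lead p 0 (\<lambda>x. 0)"
  using exp_O_monom[of 0 "Suc p"] by (simp add: lead_def)

lemma lead_one: "lead 0 1 (\<lambda>x. 1)"
  using exp_O_monom[of 0 "Suc 0"] by (simp add: lead_def)

lemma lead_power:
  assumes "lead p a u"
  shows "lead (p * j) (a ^ j) (\<lambda>x. u x ^ j)"
proof (induction j)
  case 0 show ?case using lead_one by simp
next
  case (Suc j) show ?case using lead_mult[OF assms Suc.IH] by simp
qed

text \<open>Induction on \<open>j\<close> peels off one factor at a time; each of the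
  \<open>j\<close> steps contributes one copy of \<open>a ^ (j - 1) * b\<close>. The order is
  \<open>Suc k\<close> from the difference plus \<open>j - 1\<close> from the remaining
  factors.\<close>

lemma lead_diff_power:
  assumes u: "lead 1 a u" and v: "lead 1 a v" and d: "lead (Suc k) b (\<lambda>x. u x - v x)"
  shows "lead (k + j) (real j * a ^ (j - 1) * b) (\<lambda>x. u x ^ j - v x ^ j)"
proof (induction j)
  case 0 show ?case using lead_zero by simp
next
  case (Suc j)
  have 1: "lead (1 + (k + j)) (a * (real j * a ^ (j - 1) * b)) (\<lambda>x. u x * (u x ^ j - v x ^ j))"
    by (rule lead_mult[OF u Suc.IH])
  have 2: "lead (Suc k + 1 * j) (b * a ^ j) (\<lambda>x. (u x - v x) * v x ^ j)"
    by (rule lead_mult[OF d lead_power[OF v]])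
  \<comment> \<open>At \<open>j = 0\<close> truncated subtraction makes \<open>a ^ (j - 1)\<close>
    equal to \<open>1\<close>, but the factor \<open>real j\<close> is then
    \<open>0\<close>.\<close>
  have e: "a * (real j * a ^ (j - 1) * b) + b * a ^ j = real (Suc j) * a ^ (Suc j - 1) * b"
    by (cases j) (auto simp: algebra_simps)
  have f: "(\<lambda>x. u x ^ Suc j - v x ^ Suc j) = (\<lambda>x. u x * (u x ^ j - v x ^ j) + (u x - v x) * v x ^ j)"
    by (simp add: fun_eq_iff algebra_simps)
  have g: "Suc k + 1 * j = k + Suc j" "1 + (k + j) = k + Suc j" by simp_all
  show ?case
    unfolding f e[symmetric] by (rule lead_add[OF 1[unfolded g] 2[unfolded g]])
qed

section \<open>Laplace integrals and the first term of Watson's lemma\<close>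

definition laplace :: "(real \<Rightarrow> real) \<Rightarrow> real \<Rightarrow> real" where
  "laplace u t = (LBINT x:{0..}. exp (- t * x) * u x)"

text \<open>On the half line the integrand is \<open>fact p / t ^ Suc p\<close> times an Erlang
  density, which has total mass 1.\<close>

lemma laplace_monom:
  fixes t :: real
  assumes t: "0 < t"
  shows "set_integrable lborel {0..} (\<lambda>x. exp (- t * x) * x ^ p)"
    and "(LBINT x:{0..}. exp (- t * x) * x ^ p) = fact p / t ^ Suc p"
proof -
  interpret prob_space "density lborel (erlang_density p t)"
    by (rule prob_space_erlang_density[OF t])
  have nn: "AE x in lborel. 0 \<le> erlang_density p t x" using t by auto
  have "integrable (density lborel (erlang_density p t)) (\<lambda>x. 1::real)" by simp
  then have i: "integrable lborel (erlang_density p t)"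
    using t by (subst (asm) integrable_density) auto
  have "(\<integral>x. 1 \<partial>density lborel (erlang_density p t)) = (1::real)"
    using prob_space by simp
  then have e: "(\<integral>x. erlang_density p t x \<partial>lborel) = 1"
    using t by (subst (asm) integral_density) auto
  have eq: "(\<lambda>x. indicator {0..} x *\<^sub>R (exp (- t * x) * x ^ p))
    = (\<lambda>x. fact p / t ^ Suc p * erlang_density p t x)"
    using t by (auto simp: fun_eq_iff erlang_density_def field_simps split: split_indicator)
  show "set_integrable lborel {0..} (\<lambda>x. exp (- t * x) * x ^ p)"
    unfolding set_integrable_def eq using i by (rule integrable_mult_right)
  show "(LBINT x:{0..}. exp (- t * x) * x ^ p) = fact p / t ^ Suc p"
    unfolding set_lebesgue_integral_def eq using i e by simp
qed

text \<open>The growth factor \<open>exp (B * x)\<close> merely shifts \<open>t\<close> to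
  \<open>t - B\<close>, which reduces everything to the integral of a monomial.\<close>

lemma exp_O_laplace_bound:
  assumes u: "\<And>x. 0 \<le> x \<Longrightarrow> \<bar>u x\<bar> \<le> C * x ^ p * exp (B * x)" "u \<in> borel_measurable borel"
    and t: "B < t"
  shows "set_integrable lborel {0..} (\<lambda>x. exp (- t * x) * u x)"
    and "\<bar>laplace u t\<bar> \<le> C * fact p / (t - B) ^ Suc p"
proof -
  have i: "set_integrable lborel {0..} (\<lambda>x. C * (exp (- (t - B) * x) * x ^ p))"
    using laplace_monom(1)[of "t - B" p] t by (intro set_integrable_mult_right) auto
  have b: "\<bar>exp (- t * x) * u x\<bar> \<le> C * (exp (- (t - B) * x) * x ^ p)" if "0 \<le> x" for x
  proof -
    have "\<bar>exp (- t * x) * u x\<bar> = exp (- t * x) * \<bar>u x\<bar>" by (simp add: abs_mult)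
    also have "\<dots> \<le> exp (- t * x) * (C * x ^ p * exp (B * x))"
      using u(1)[OF that] by (intro mult_left_mono) auto
    also have "\<dots> = C * (exp (- (t - B) * x) * x ^ p)"
      by (simp add: algebra_simps flip: exp_add)
    finally show ?thesis .
  qed
  show i2: "set_integrable lborel {0..} (\<lambda>x. exp (- t * x) * u x)"
    using i unfolding set_integrable_def
  proof (rule Bochner_Integration.integrable_bound)
    show "(\<lambda>x. indicator {0..} x *\<^sub>R (exp (- t * x) * u x)) \<in> borel_measurable lborel"
      using u(2) by measurable
    show "AE x in lborel. norm (indicator {0..} x *\<^sub>R (exp (- t * x) * u x))
       \<le> norm (indicator {0..} x *\<^sub>R (C * (exp (- (t - B) * x) * x ^ p)))"
    proof (rule AE_I2)
      fix x
      show "norm (indicator {0..} x *\<^sub>R (exp (- t * x) * u x))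
       \<le> norm (indicator {0..} x *\<^sub>R (C * (exp (- (t - B) * x) * x ^ p)))"
        using order_trans[OF b abs_ge_self, of x] by (cases "0 \<le> x") simp_all
    qed
  qed
  have "\<bar>laplace u t\<bar> \<le> (LBINT x:{0..}. \<bar>exp (- t * x) * u x\<bar>)"
    unfolding laplace_def using set_integral_norm_bound[OF i2] by simp
  also have "\<dots> \<le> (LBINT x:{0..}. C * (exp (- (t - B) * x) * x ^ p))"
    using b by (intro set_integral_mono i set_integrable_abs[OF i2]) auto
  also have "\<dots> = C * fact p / (t - B) ^ Suc p"
    using t by (subst set_integral_mult_right) (simp only: laplace_monom(2)[of "t - B" p] diff_gt_0_iff_gt times_divide_eq_right)
  finally show "\<bar>laplace u t\<bar> \<le> C * fact p / (t - B) ^ Suc p" .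
qed

lemma exp_O_eventually_integrable:
  assumes "u \<in> exp_O p"
  shows "eventually (\<lambda>t. set_integrable lborel {0..} (\<lambda>x. exp (- t * x) * u x)) at_top"
proof -
  obtain C B where 1: "0 \<le> C" "0 \<le> B" "\<And>x. 0 \<le> x \<Longrightarrow> \<bar>u x\<bar> \<le> C * x ^ p * exp (B * x)"
    using exp_O_E[OF assms(1)] by blast
  show ?thesis
    using exp_O_laplace_bound(1)[OF 1(3) exp_O_measurable[OF assms]]
    by (rule eventually_mono[OF eventually_gt_at_top[of B]])
qed

text \<open>The monomial contributes exactly \<open>a * fact p\<close>; the remainder is one order
  smaller at \<open>0\<close>, so its scaled transform decays like \<open>1 / t\<close>.\<close>

lemma lead_laplace_limit:
  assumes l: "lead p a u"
  shows "((\<lambda>t. t ^ Suc p * laplace u t) \<longlongrightarrow> a * fact p) at_top"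
proof -
  let ?r = "\<lambda>x. u x - a * x ^ p"
  have rO: "?r \<in> exp_O (Suc p)" using l by (simp add: lead_def)
  obtain C B where 1: "0 \<le> C" "0 \<le> B" "\<And>x. 0 \<le> x \<Longrightarrow> \<bar>?r x\<bar> \<le> C * x ^ Suc p * exp (B * x)"
    using exp_O_E[OF rO] by blast
  have split: "eventually (\<lambda>t. t ^ Suc p * laplace u t = t ^ Suc p * laplace ?r t + a * fact p) at_top"
    using exp_O_eventually_integrable[OF rO] eventually_gt_at_top[of "0::real"]
  proof eventually_elim
    case (elim t)
    have "laplace u t = (LBINT x:{0..}. exp (- t * x) * ?r x + a * (exp (- t * x) * x ^ p))"
      unfolding laplace_def by (intro set_lebesgue_integral_cong) (auto simp: algebra_simps)
    also have "\<dots> = laplace ?r t + a * (fact p / t ^ Suc p)"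
      unfolding laplace_def using elim laplace_monom[of t p]
      by (subst set_integral_add) (auto simp del: power_Suc)
    finally show ?case using elim by (simp add: algebra_simps)
  qed
  have "((\<lambda>t. t ^ Suc p * laplace ?r t) \<longlongrightarrow> 0) at_top"
  proof (rule Lim_null_comparison)
    show "eventually (\<lambda>t. norm (t ^ Suc p * laplace ?r t) \<le> C * fact (Suc p) * (t / (t - B)) ^ Suc p * (1 / (t - B))) at_top"
      using eventually_gt_at_top[of B]
    proof eventually_elim
      case (elim t)
      have "\<bar>laplace ?r t\<bar> \<le> C * fact (Suc p) / (t - B) ^ Suc (Suc p)"
        using exp_O_laplace_bound(2)[OF 1(3) exp_O_measurable[OF rO] elim] .
      then have "t ^ Suc p * \<bar>laplace ?r t\<bar> \<le> t ^ Suc p * (C * fact (Suc p) / (t - B) ^ Suc (Suc p))"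
        using elim 1(2) by (intro mult_left_mono) auto
      also have "\<dots> = C * fact (Suc p) * (t / (t - B)) ^ Suc p * (1 / (t - B))"
        by (simp add: power_divide mult_ac)
      finally show ?case using elim 1(2) by (simp add: abs_mult)
    qed
    have e1: "((\<lambda>t. t / (t - B)) \<longlongrightarrow> 1) at_top" by real_asymp
    have e2: "((\<lambda>t. 1 / (t - B)) \<longlongrightarrow> 0) at_top" by real_asymp
    have "((\<lambda>t. C * fact (Suc p) * (t / (t - B)) ^ Suc p * (1 / (t - B))) \<longlongrightarrow> C * fact (Suc p) * 1 ^ Suc p * 0) at_top"
      by (intro tendsto_intros e1 e2)
    then show "((\<lambda>t. C * fact (Suc p) * (t / (t - B)) ^ Suc p * (1 / (t - B))) \<longlongrightarrow> 0) at_top"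
      by simp
  qed
  then have "((\<lambda>t. t ^ Suc p * laplace ?r t + a * fact p) \<longlongrightarrow> 0 + a * fact p) at_top"
    by (intro tendsto_intros)
  then show ?thesis by (subst filterlim_cong[OF refl refl split]) simp
qed

lemma laplace_diff:
  assumes "u \<in> exp_O p" "v \<in> exp_O q"
  shows "eventually (\<lambda>t. laplace (\<lambda>x. u x - v x) t = laplace u t - laplace v t) at_top"
  using exp_O_eventually_integrable[OF assms(1)] exp_O_eventually_integrable[OF assms(2)]
proof eventually_elim
  case (elim t)
  then show ?case unfolding laplace_def
    by (subst set_integral_diff(2)[symmetric]) (auto simp: algebra_simps)
qed

section \<open>Perturbing the exponential model\<close>

lemma exp_O_power: "u \<in> exp_O 1 \<Longrightarrow> (\<lambda>x. u x ^ j) \<in> exp_O j"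
proof (induction j)
  case 0 show ?case using exp_O_monom[of 1 0] by simp
next
  case (Suc j)
  show ?case using exp_O_mult[OF Suc.prems Suc.IH[OF Suc.prems]] by simp
qed

text \<open>Integration by parts. The boundary term at \<open>0\<close> vanishes because
  \<open>exp_O 1\<close> forces \<open>u 0 = 0\<close>, the one at infinity because \<open>t\<close>
  exceeds the growth rate \<open>B\<close>.\<close>

lemma laplace_deriv:
  fixes u u' :: "real \<Rightarrow> real"
  assumes u: "u \<in> exp_O 1" and u': "u' \<in> exp_O p"
    and d: "\<And>x. (u has_real_derivative u' x) (at x)" and c: "\<And>x. isCont u' x"
  shows "eventually (\<lambda>t. t * laplace u t = laplace u' t) at_top"
proof -
  obtain C B where 1: "0 \<le> C" "0 \<le> B" "\<And>x. 0 \<le> x \<Longrightarrow> \<bar>u x\<bar> \<le> C * x ^ 1 * exp (B * x)"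
    using exp_O_E[OF u] by blast
  show ?thesis
    using exp_O_eventually_integrable[OF u] exp_O_eventually_integrable[OF u'] eventually_gt_at_top[of B]
  proof eventually_elim
    case (elim t)
    let ?G = "\<lambda>x. exp (- t * x) * u x"
    let ?g = "\<lambda>x. exp (- t * x) * u' x - t * (exp (- t * x) * u x)"
    have gi: "set_integrable lborel {0..} ?g"
      using elim by (intro set_integral_diff set_integrable_mult_right) auto
    have gi': "set_integrable lborel {0<..} ?g"
      by (rule set_integrable_subset[OF gi]) auto
    \<comment> \<open>The fundamental theorem is stated for the open interval; the closed half line
      differs from it by a null set.\<close>
    have e1: "(LBINT x:{0..}. ?g x) = (LBINT x:{0<..}. ?g x)"
      by (rule set_integral_discrete_difference[where X = "{0}"]) auto
    have bG: "norm (?G x) \<le> C * x * exp ((B - t) * x)" if "0 \<le> x" for x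
    proof -
      have "norm (?G x) = exp (- t * x) * \<bar>u x\<bar>" by (simp add: abs_mult)
      also have "\<dots> \<le> exp (- t * x) * (C * x ^ 1 * exp (B * x))"
        using 1(3)[OF that] by (intro mult_left_mono) auto
      also have "\<dots> = C * x * exp ((B - t) * x)" by (simp add: algebra_simps flip: exp_add)
      finally show ?thesis .
    qed
    have L0: "(?G \<longlongrightarrow> 0) (at_right 0)"
    proof (rule Lim_null_comparison)
      show "\<forall>\<^sub>F x in at_right 0. norm (?G x) \<le> C * x * exp ((B - t) * x)"
        using eventually_at_right_less[of "0::real"] by eventually_elim (rule bG, simp)
      have "((\<lambda>x. C * x * exp ((B - t) * x)) \<longlongrightarrow> C * 0 * exp ((B - t) * 0)) (at_right 0)"
        by (intro tendsto_intros)
      then show "((\<lambda>x. C * x * exp ((B - t) * x)) \<longlongrightarrow> 0) (at_right 0)" by simp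
    qed
    have L1: "(?G \<longlongrightarrow> 0) at_top"
    proof (rule Lim_null_comparison)
      show "\<forall>\<^sub>F x in at_top. norm (?G x) \<le> C * x * exp ((B - t) * x)"
        using eventually_ge_at_top[of "0::real"] by eventually_elim (rule bG)
      have "B - t < 0" using elim by simp
      then have "((\<lambda>x. x * exp ((B - t) * x)) \<longlongrightarrow> 0) at_top"
        by real_asymp
      then show "((\<lambda>x. C * x * exp ((B - t) * x)) \<longlongrightarrow> 0) at_top"
        using tendsto_mult_right_zero[of "\<lambda>x. x * exp ((B - t) * x)" at_top C]
        by (simp add: mult.assoc)
    qed
    have D: "(?G has_real_derivative ?g x) (at x)" for x
      by (auto intro!: derivative_eq_intros d)
    have "(LBINT x=0..\<infinity>. ?g x) = 0 - 0"
    proof (rule interval_integral_FTC_integrable[where F = ?G])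
      show "(?G has_vector_derivative ?g x) (at x)" for x
        using D[of x] by (simp add: has_real_derivative_iff_has_vector_derivative)
      show "isCont ?g x" for x
        using c[of x] DERIV_isCont[OF d[of x]] by (intro continuous_intros)
      show "set_integrable lborel (einterval 0 \<infinity>) ?g"
        using gi' by (simp add: zero_ereal_def)
      show "((?G \<circ> real_of_ereal) \<longlongrightarrow> 0) (at_right 0)"
        unfolding zero_ereal_def ereal_tendsto_simps1 by (rule L0)
      show "((?G \<circ> real_of_ereal) \<longlongrightarrow> 0) (at_left \<infinity>)"
        unfolding ereal_tendsto_simps1 by (rule L1)
    qed simp
    then have "0 = (LBINT x:{0..}. ?g x)"
      by (simp only: interval_lebesgue_integral_0_infty e1)
    also have "\<dots> = laplace u' t - t * laplace u t"
      unfolding laplace_def using elim by (subst set_integral_diff(2)) auto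
    finally show ?case by simp
  qed
qed

section \<open>The exponential model solves the transformed equation exactly\<close>

lemma eventually_at_top_scale:
  assumes "eventually P (at_top :: real filter)" "0 < c"
  shows "eventually (\<lambda>t. P (t / c)) at_top"
proof -
  have "filterlim (\<lambda>t::real. t / c) at_top at_top"
    using assms(2) by real_asymp
  then show ?thesis using assms(1) by (simp add: filterlim_iff)
qed

text \<open>The differential equation makes the derivative of \<open>H ^ Suc j\<close> a linear
  combination of \<open>H ^ j\<close> and \<open>H ^ Suc j\<close>; \<open>laplace_deriv\<close>
  turns this into a recursion.\<close>

lemma laplace_power_model_step:
  assumes HO: "H \<in> exp_O 1" and dH: "\<And>x. (H has_real_derivative a + \<mu> * H x) (at x)"
  shows "eventually (\<lambda>t. (t - real (Suc j) * \<mu>) * laplace (\<lambda>x. H x ^ Suc j) t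
           = real (Suc j) * a * laplace (\<lambda>x. H x ^ j) t) at_top"
proof -
  let ?u' = "\<lambda>x. real (Suc j) * a * H x ^ j + real (Suc j) * \<mu> * H x ^ Suc j"
  have O1: "(\<lambda>x. H x ^ Suc j) \<in> exp_O 1" and O0: "(\<lambda>x. H x ^ j) \<in> exp_O 0"
      and O2: "(\<lambda>x. H x ^ Suc j) \<in> exp_O 0"
    using exp_O_power[OF HO, of "Suc j"] exp_O_power[OF HO, of j] exp_O_mono by (auto simp del: power_Suc)
  have cH: "isCont H x" for x using DERIV_isCont[OF dH] .
  have "eventually (\<lambda>t. t * laplace (\<lambda>x. H x ^ Suc j) t = laplace ?u' t) at_top"
  proof (rule laplace_deriv[OF O1])
    show "?u' \<in> exp_O 0" by (intro exp_O_add exp_O_cmult O0 O2)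
    show "((\<lambda>x. H x ^ Suc j) has_real_derivative ?u' x) (at x)" for x
      by (rule derivative_eq_intros dH refl)+ (simp add: algebra_simps)
    show "isCont ?u' x" for x using cH by (intro continuous_intros)
  qed
  then show ?thesis
    using exp_O_eventually_integrable[OF O0] exp_O_eventually_integrable[OF O2]
  proof eventually_elim
    case (elim t)
    have "laplace ?u' t = (LBINT x:{0..}. real (Suc j) * a * (exp (- t * x) * H x ^ j)
        + real (Suc j) * \<mu> * (exp (- t * x) * H x ^ Suc j))"
      unfolding laplace_def by (intro set_lebesgue_integral_cong) (auto simp: algebra_simps)
    also have "\<dots> = real (Suc j) * a * laplace (\<lambda>x. H x ^ j) t
        + real (Suc j) * \<mu> * laplace (\<lambda>x. H x ^ Suc j) t"
      unfolding laplace_def using elim by (subst set_integral_add(2)) (auto simp del: power_Suc)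
    finally show ?case using elim(1) by (simp add: algebra_simps del: power_Suc)
  qed
qed

text \<open>With \<open>s = t / real (Suc j)\<close> the recursion yields the factor
  \<open>a / (s - \<mu>)\<close>, and its case \<open>j = 0\<close> identifies that factor as
  \<open>s * laplace H s\<close>. For \<open>\<mu> = - a\<close> this is the classical
  representation of an exponential maximum as the maximum of one variable fewer plus an independent
  scaled copy.\<close>

lemma laplace_power_model_ratio:
  assumes HO: "H \<in> exp_O 1" and dH: "\<And>x. (H has_real_derivative a + \<mu> * H x) (at x)"
  shows "eventually (\<lambda>t. laplace (\<lambda>x. H x ^ Suc j) t
           = laplace (\<lambda>x. H x ^ j) t * (t / real (Suc j) * laplace H (t / real (Suc j)))) at_top"
proof -
  have "eventually (\<lambda>t. (t - \<mu>) * laplace H t = a / t) at_top"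
    using laplace_power_model_step[OF HO dH, of 0] eventually_gt_at_top[of "0::real"]
  proof eventually_elim
    case (elim t)
    have "laplace (\<lambda>x. 1) t = 1 / t"
      unfolding laplace_def using laplace_monom(2)[OF elim(2), of 0] by simp
    then show ?case using elim by simp
  qed
  then have "eventually (\<lambda>t. (t / real (Suc j) - \<mu>) * laplace H (t / real (Suc j))
      = a / (t / real (Suc j))) at_top"
    by (rule eventually_at_top_scale) simp
  then show ?thesis
    using laplace_power_model_step[OF HO dH, of j] eventually_gt_at_top[of "0::real"]
      eventually_gt_at_top[of "real (Suc j) * \<mu>"]
  proof eventually_elim
    case (elim t)
    define s where "s = t / real (Suc j)"
    have t: "t = s * real (Suc j)" by (simp add: s_def)
    have s: "0 < s" "s - \<mu> \<noteq> 0" using elim by (auto simp: s_def field_simps)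
    have 1: "s * laplace H s = a / (s - \<mu>)"
      using elim(1) s unfolding s_def[symmetric] by (simp add: field_simps)
    have "real (Suc j) * ((s - \<mu>) * laplace (\<lambda>x. H x ^ Suc j) t)
        = real (Suc j) * (a * laplace (\<lambda>x. H x ^ j) t)"
      using elim(2) unfolding t by (simp add: algebra_simps del: power_Suc)
    then have "(s - \<mu>) * laplace (\<lambda>x. H x ^ Suc j) t = a * laplace (\<lambda>x. H x ^ j) t"
      by (simp del: power_Suc of_nat_Suc)
    then have "laplace (\<lambda>x. H x ^ Suc j) t = laplace (\<lambda>x. H x ^ j) t * (a / (s - \<mu>))"
      using s by (simp add: field_simps del: power_Suc)
    then show ?case unfolding s_def[symmetric] 1 .
  qed
qed

lemma laplace_power_model:
  assumes HO: "H \<in> exp_O 1" and dH: "\<And>x. (H has_real_derivative a + \<mu> * H x) (at x)"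
    and mn: "m \<le> n"
  shows "eventually (\<lambda>t. laplace (\<lambda>x. H x ^ n) t
           = laplace (\<lambda>x. H x ^ m) t * (\<Prod>i=m+1..n. t / real i * laplace H (t / real i))) at_top"
  using mn
proof (induction n rule: dec_induct)
  case base show ?case by simp
next
  case (step n)
  show ?case using step.IH laplace_power_model_ratio[OF HO dH, of n]
  proof eventually_elim
    case (elim t)
    show ?case
      unfolding elim(2) elim(1) using step(1) by (simp add: prod.cl_ivl_Suc)
  qed
qed

text \<open>\<open>r\<close> is the relative difference of \<open>u\<close> and \<open>v\<close> at order \<open>t\<^sup>-\<^sup>k\<close>; it is additive
  under products.\<close>
definition asym_rel :: "nat \<Rightarrow> (real \<Rightarrow> real) \<Rightarrow> (real \<Rightarrow> real) \<Rightarrow> real \<Rightarrow> real \<Rightarrow> bool" where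
  "asym_rel k u v b r \<longleftrightarrow> (u \<longlongrightarrow> b) at_top \<and> (v \<longlongrightarrow> b) at_top \<and>
     ((\<lambda>t. t ^ k * (u t - v t)) \<longlongrightarrow> b * r) at_top"

text \<open>A product rule: \<open>u * u' - v * v' = (u - v) * u' + v * (u' - v')\<close>.\<close>

lemma asym_rel_mult:
  assumes "asym_rel k u v b r" "asym_rel k u' v' b' r'"
  shows "asym_rel k (\<lambda>t. u t * u' t) (\<lambda>t. v t * v' t) (b * b') (r + r')"
proof -
  have 1: "((\<lambda>t. t ^ k * (u t - v t)) \<longlongrightarrow> b * r) at_top" "(u' \<longlongrightarrow> b') at_top"
    "((\<lambda>t. t ^ k * (u' t - v' t)) \<longlongrightarrow> b' * r') at_top" "(v \<longlongrightarrow> b) at_top"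
    using assms unfolding asym_rel_def by auto
  have "((\<lambda>t. (t ^ k * (u t - v t)) * u' t + v t * (t ^ k * (u' t - v' t)))
      \<longlongrightarrow> (b * r) * b' + b * (b' * r')) at_top"
    by (rule tendsto_add[OF tendsto_mult[OF 1(1,2)] tendsto_mult[OF 1(4,3)]])
  then have "((\<lambda>t. t ^ k * (u t * u' t - v t * v' t)) \<longlongrightarrow> (b * b') * (r + r')) at_top"
    by (simp add: algebra_simps)
  then show ?thesis
    using assms unfolding asym_rel_def by (auto intro: tendsto_mult)
qed

lemma asym_rel_prod:
  assumes "finite I" "\<And>i. i \<in> I \<Longrightarrow> asym_rel k (u i) (v i) (b i) (r i)"
  shows "asym_rel k (\<lambda>t. \<Prod>i\<in>I. u i t) (\<lambda>t. \<Prod>i\<in>I. v i t) (\<Prod>i\<in>I. b i) (\<Sum>i\<in>I. r i)"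
  using assms
proof (induction I rule: finite_induct)
  case empty show ?case by (simp add: asym_rel_def)
next
  case (insert i I)
  then show ?case using asym_rel_mult[of k "u i" "v i" "b i" "r i"] by simp
qed

text \<open>Since \<open>t ^ k = c ^ k * (t / c) ^ k\<close>, rescaling multiplies the relative
  difference by \<open>c ^ k\<close>. With \<open>c = real i\<close> this is where the powers
  \<open>i ^ k\<close> come from.\<close>

lemma asym_rel_scale:
  assumes "asym_rel k u v b r" and c: "0 < c"
  shows "asym_rel k (\<lambda>t. c * u (t / c)) (\<lambda>t. c * v (t / c)) (c * b) (c ^ k * r)"
proof -
  have f: "filterlim (\<lambda>t::real. t / c) at_top at_top" using c by real_asymp
  have 1: "((\<lambda>t. u (t / c)) \<longlongrightarrow> b) at_top" "((\<lambda>t. v (t / c)) \<longlongrightarrow> b) at_top"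
    "((\<lambda>t. (t / c) ^ k * (u (t / c) - v (t / c))) \<longlongrightarrow> b * r) at_top"
    using assms(1) unfolding asym_rel_def by (auto intro: filterlim_compose[OF _ f])
  have "((\<lambda>t. (c * c ^ k) * ((t / c) ^ k * (u (t / c) - v (t / c)))) \<longlongrightarrow> (c * c ^ k) * (b * r)) at_top"
    by (intro tendsto_intros 1)
  then have "((\<lambda>t. t ^ k * (c * u (t / c) - c * v (t / c))) \<longlongrightarrow> (c * b) * (c ^ k * r)) at_top"
    using c by (simp add: algebra_simps power_divide)
  then show ?thesis unfolding asym_rel_def using 1 by (auto intro: tendsto_intros)
qed

text \<open>Induction from \<open>k = 2\<close>: raising \<open>k\<close> by one multiplies the left
  side by \<open>(k + 1 + n) / (k + 1)\<close>, which is at most the new factor \<open>n + 1\<close>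
  on the right. At \<open>k = 1\<close> both sides agree, which is why the model has to match the
  density to first order.\<close>

lemma choose_less_power:
  fixes n k :: nat
  assumes "1 \<le> n" "2 \<le> k"
  shows "(k + n choose k) < (n + 1) ^ k"
proof -
  have "Suc (Suc k) + n choose Suc (Suc k) < (n + 1) ^ Suc (Suc k)" for k
  proof (induction k)
    case 0
    have "Suc (Suc 0) + n choose Suc (Suc 0) = Suc (Suc n) * Suc n div 2"
      by (simp add: choose_two numeral_2_eq_2[symmetric])
    also have "\<dots> < Suc n * Suc n"
      using assms(1) by (intro less_mult_imp_div_less) (simp add: algebra_simps)
    finally show ?case by simp
  next
    case (Suc k)
    let ?q = "Suc (Suc k)"
    have "(Suc ?q + n choose Suc ?q) * Suc ?q = (Suc (?q + n)) * (?q + n choose ?q)"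
      using Suc_times_binomial_eq[of "?q + n" ?q] by (simp add: mult.commute)
    also have "\<dots> < Suc (?q + n) * (n + 1) ^ ?q"
      using Suc.IH by (intro mult_strict_left_mono) auto
    also have "\<dots> \<le> (Suc ?q * (n + 1)) * (n + 1) ^ ?q"
      by (intro mult_right_mono) (auto simp: algebra_simps)
    also have "\<dots> = (n + 1) ^ Suc ?q * Suc ?q" by (simp only: power_Suc mult_ac)
    finally show ?case using mult_less_cancel2 by blast
  qed
  moreover have "Suc (Suc (k - 2)) = k" using assms(2) by simp
  ultimately show ?thesis by metis
qed

text \<open>By Pascal's rule, passing from \<open>n\<close> to \<open>Suc n\<close> adds
  \<open>k + n choose k\<close> on the left and the larger \<open>Suc n ^ k\<close> on the
  right.\<close>

lemma choose_less_sum_power: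
  fixes k m n :: nat
  assumes "1 \<le> m" "m < n" "2 \<le> k"
  shows "(k + n choose Suc k) < (k + m choose Suc k) + (\<Sum>i=m+1..n. i ^ k)"
proof -
  have "Suc m \<le> n" using assms by simp
  then show ?thesis
  proof (induction n rule: dec_induct)
    case base
    show ?case using choose_less_power[OF assms(1,3)] by simp
  next
    case (step n)
    have "k + Suc n choose Suc k = (k + n choose k) + (k + n choose Suc k)" by simp
    moreover have "(k + n choose k) < Suc n ^ k"
      using choose_less_power[of n k] step assms by simp
    moreover have "(\<Sum>i=m+1..Suc n. i ^ k) = (\<Sum>i=m+1..n. i ^ k) + Suc n ^ k"
      using step by simp
    ultimately show ?case using step.IH by linarith
  qed
qed

text \<open>The \<open>j\<close>-th powers first differ at order \<open>k + j\<close>, with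
  coefficient \<open>j * a ^ (j - 1) * c\<close>, and transforming contributes
  \<open>fact (k + j)\<close>. Dividing by the leading coefficient \<open>a ^ j * fact j\<close>
  leaves \<open>c / a * fact (k + j) / fact (j - 1)\<close>, rewritten with a binomial
  coefficient.\<close>

lemma asym_rel_laplace_power:
  assumes a: "a \<noteq> 0" and F: "lead 1 a F" and H: "lead 1 a H"
    and D: "lead (Suc k) c (\<lambda>x. F x - H x)" and j: "1 \<le> j"
  shows "asym_rel k (\<lambda>t. t ^ Suc j * laplace (\<lambda>x. F x ^ j) t) (\<lambda>t. t ^ Suc j * laplace (\<lambda>x. H x ^ j) t)
     (a ^ j * fact j) (c / a * fact (Suc k) * real (k + j choose Suc k))"
proof -
  have LF: "lead j (a ^ j) (\<lambda>x. F x ^ j)" and LH: "lead j (a ^ j) (\<lambda>x. H x ^ j)"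
    using lead_power[OF F, of j] lead_power[OF H, of j] by simp_all
  have "((\<lambda>t. t ^ Suc (k + j) * laplace (\<lambda>x. F x ^ j - H x ^ j) t)
      \<longlongrightarrow> real j * a ^ (j - 1) * c * fact (k + j)) at_top"
    by (rule lead_laplace_limit[OF lead_diff_power[OF F H D]])
  moreover have "eventually (\<lambda>t. t ^ Suc (k + j) * laplace (\<lambda>x. F x ^ j - H x ^ j) t
      = t ^ k * (t ^ Suc j * laplace (\<lambda>x. F x ^ j) t - t ^ Suc j * laplace (\<lambda>x. H x ^ j) t)) at_top"
    using laplace_diff[OF lead_imp_exp_O[OF LF] lead_imp_exp_O[OF LH]]
  proof eventually_elim
    case (elim t)
    show ?case unfolding elim by (simp add: algebra_simps power_add)
  qed
  ultimately have 1: "((\<lambda>t. t ^ k * (t ^ Suc j * laplace (\<lambda>x. F x ^ j) t - t ^ Suc j * laplace (\<lambda>x. H x ^ j) t))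
      \<longlongrightarrow> real j * a ^ (j - 1) * c * fact (k + j)) at_top"
    by (rule Lim_transform_eventually)
  obtain i where i: "j = Suc i" using j by (cases j) auto
  have "real (k + j choose Suc k) = fact (k + j) / (fact (Suc k) * fact i)"
    unfolding i by (subst binomial_fact) auto
  then have 2: "fact (k + j) = fact (Suc k) * fact i * real (k + j choose Suc k)"
    by (simp del: fact_Suc binomial_Suc_Suc)
  have "a ^ j = a * a ^ i" "(fact j :: real) = real j * fact i" "j - 1 = i"
    by (simp_all add: i)
  then have "real j * a ^ (j - 1) * c * fact (k + j)
      = a ^ j * fact j * (c / a * fact (Suc k) * real (k + j choose Suc k))"
    using a unfolding 2 by (simp del: fact_Suc binomial_Suc_Suc)
  with 1 show ?thesis
    unfolding asym_rel_def using lead_laplace_limit[OF LF] lead_laplace_limit[OF LH] by simp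
qed

text \<open>\<open>F\<close> by hypothesis and \<open>H\<close> by
  \<open>laplace_power_model\<close> satisfy the same equation, so the relative differences of its
  two sides at order \<open>k\<close> must agree. The strict binomial inequality leaves only
  \<open>c = 0\<close>.\<close>

lemma coefficient_eq_0:
  assumes mn: "1 \<le> m" "m < n" and k: "2 \<le> k" and a: "0 < a"
    and F: "lead 1 a F" and H: "lead 1 a H" and D: "lead (Suc k) c (\<lambda>x. F x - H x)"
    and dH: "\<And>x. (H has_real_derivative a + \<mu> * H x) (at x)"
    and eqF: "eventually (\<lambda>t. laplace (\<lambda>x. F x ^ n) t
       = laplace (\<lambda>x. F x ^ m) t * (\<Prod>i=m+1..n. t / real i * laplace F (t / real i))) at_top"
  shows "c = 0"
proof -
  \<comment> \<open>The power of \<open>t\<close> normalizes the transform to a finite nonzero limit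
    for \<open>F\<close> and \<open>H\<close> when \<open>1 \<le> j\<close>.\<close>
  define T where "T U j t = t ^ Suc j * laplace (\<lambda>x. U x ^ j) t" for U :: "real \<Rightarrow> real" and j t
  define R where "R j = c / a * fact (Suc k) * real (k + j choose Suc k)" for j
  have T: "asym_rel k (T F j) (T H j) (a ^ j * fact j) (R j)" if "1 \<le> j" for j
    unfolding T_def R_def using asym_rel_laplace_power[OF _ F H D that] a by simp
  have P: "asym_rel k (\<lambda>t. real i * T F 1 (t / real i)) (\<lambda>t. real i * T H 1 (t / real i))
      (real i * (a ^ 1 * fact 1)) (real i ^ k * R 1)" if "i \<in> {m+1..n}" for i
    using that by (intro asym_rel_scale T) auto
  define G where "G U t = T U m t * (\<Prod>i=m+1..n. real i * T U 1 (t / real i))" for U t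
  let ?b = "(a ^ m * fact m) * (\<Prod>i=m+1..n. real i * (a ^ 1 * fact 1))"
  have Q: "asym_rel k (G F) (G H) ?b (R m + (\<Sum>i=m+1..n. real i ^ k * R 1))"
    unfolding G_def using mn by (intro asym_rel_mult T asym_rel_prod P) auto
  have eq: "eventually (\<lambda>t. T U n t = G U t) at_top"
    if U: "eventually (\<lambda>t. laplace (\<lambda>x. U x ^ n) t
       = laplace (\<lambda>x. U x ^ m) t * (\<Prod>i=m+1..n. t / real i * laplace U (t / real i))) at_top" for U
    using U
  proof eventually_elim
    case (elim t)
    \<comment> \<open>One extra factor \<open>t\<close> per index; together these
      \<open>n - m\<close> factors raise \<open>t ^ Suc m\<close> to
      \<open>t ^ Suc n\<close>.\<close>
    have "real i * T U 1 (t / real i) = t * (t / real i * laplace U (t / real i))" if "i \<in> {m+1..n}" for i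
      using that by (simp add: T_def)
    then have "(\<Prod>i=m+1..n. real i * T U 1 (t / real i))
        = (\<Prod>i=m+1..n. t * (t / real i * laplace U (t / real i)))"
      by (rule prod.cong[OF refl])
    also have "\<dots> = t ^ (n - m) * (\<Prod>i=m+1..n. t / real i * laplace U (t / real i))"
      by (subst prod.distrib) simp
    finally have "(\<Prod>i=m+1..n. real i * T U 1 (t / real i))
        = t ^ (n - m) * (\<Prod>i=m+1..n. t / real i * laplace U (t / real i))" .
    then have "G U t = t ^ Suc m * laplace (\<lambda>x. U x ^ m) t
        * (t ^ (n - m) * (\<Prod>i=m+1..n. t / real i * laplace U (t / real i)))"
      by (simp only: G_def) (simp only: T_def)
    moreover have "t ^ Suc n = t ^ Suc m * t ^ (n - m)"
      using mn by (simp flip: power_add)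
    ultimately show ?case by (simp only: T_def elim mult_ac)
  qed
  have eF: "eventually (\<lambda>t. T F n t = G F t) at_top" by (rule eq[OF eqF])
  have eH: "eventually (\<lambda>t. T H n t = G H t) at_top"
    using mn by (intro eq laplace_power_model[OF lead_imp_exp_O[OF H] dH]) auto
  have Tn: "asym_rel k (T F n) (T H n) (a ^ n * fact n) (R n)" using T mn by simp
  have "(G F \<longlongrightarrow> a ^ n * fact n) at_top"
    using Tn eF unfolding asym_rel_def by (blast intro: Lim_transform_eventually)
  \<comment> \<open>The leading coefficients are matched without computing the product: both numbers
    are limits of \<open>G F\<close>.\<close>
  then have b: "a ^ n * fact n = ?b"
    using Q unfolding asym_rel_def by (blast intro: tendsto_unique[OF trivial_limit_at_top_linorder])
  have "eventually (\<lambda>t. t ^ k * (T F n t - T H n t) = t ^ k * (G F t - G H t)) at_top"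
    using eF eH by eventually_elim simp
  then have "((\<lambda>t. t ^ k * (G F t - G H t)) \<longlongrightarrow> a ^ n * fact n * R n) at_top"
    using Tn unfolding asym_rel_def by (blast intro: Lim_transform_eventually)
  then have "a ^ n * fact n * R n = ?b * (R m + (\<Sum>i=m+1..n. real i ^ k * R 1))"
    using Q unfolding asym_rel_def by (blast intro: tendsto_unique[OF trivial_limit_at_top_linorder])
  then have "R n = R m + (\<Sum>i=m+1..n. real i ^ k * R 1)"
    unfolding b[symmetric] using a by simp
  moreover have R1: "(\<Sum>i=m+1..n. real i ^ k * R 1) = c / a * fact (Suc k) * (\<Sum>i=m+1..n. real i ^ k)"
    by (simp add: R_def sum_distrib_left mult_ac del: fact_Suc)
  ultimately have "c / a * fact (Suc k) * real (k + n choose Suc k)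
     = c / a * fact (Suc k) * (real (k + m choose Suc k) + (\<Sum>i=m+1..n. real i ^ k))"
    by (simp only: R1 R_def distrib_left)
  moreover have "real (k + n choose Suc k) < real (k + m choose Suc k) + (\<Sum>i=m+1..n. real i ^ k)"
    using choose_less_sum_power[OF mn k, THEN of_nat_less_iff[where 'a=real, THEN iffD2]] by simp
  ultimately have "c / a * fact (Suc k) = 0"
    by (metis less_irrefl mult_cancel_left)
  then show "c = 0" using a by simp
qed

section \<open>Analytic densities\<close>

lemma filterlim_of_real_at_0: "filterlim complex_of_real (at 0) (at_right 0)"
proof (rule filterlim_atI)
  show "(complex_of_real \<longlongrightarrow> 0) (at_right 0)"
    using tendsto_of_real[OF tendsto_ident_at[of "0::real" "{0<..}"]] by simp
  show "\<forall>\<^sub>F x in at_right 0. complex_of_real x \<noteq> 0"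
    using eventually_at_right_less[of "0::real"] by eventually_elim simp
qed

text \<open>A full complex limit may be evaluated along the positive real axis, the only place where
  reality is known. It serves for a derivative at \<open>0\<close> and for the leading coefficient
  of a power series.\<close>

lemma Im_limit_eq_0:
  assumes "(\<phi> \<longlongrightarrow> L) (at 0)" "\<forall>\<^sub>F x in at_right 0. Im (\<phi> (complex_of_real x)) = 0"
  shows "Im L = 0"
proof -
  have "((\<lambda>x. Im (\<phi> (complex_of_real x))) \<longlongrightarrow> Im L) (at_right 0)"
    by (intro tendsto_Im filterlim_compose[OF assms(1) filterlim_of_real_at_0])
  moreover have "((\<lambda>x. Im (\<phi> (complex_of_real x))) \<longlongrightarrow> 0) (at_right 0)"
    using assms(2) by (rule tendsto_eventually)
  ultimately show ?thesis
    by (rule tendsto_unique[rotated]) simp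
qed

text \<open>On a connected set a nonconstant \<open>g\<close> has a zero of finite order
  \<open>k\<close> at \<open>0\<close>, so \<open>g w = w ^ k * h w\<close> nearby with
  \<open>h 0 \<noteq> 0\<close>. Reality on the half line makes \<open>h 0\<close> real, and
  \<open>c\<close> is its real part.\<close>

lemma holomorphic_nonneg_real_leading_term:
  assumes S: "open S" "connected S" and hol: "g holomorphic_on S"
    and sub: "complex_of_real ` {0..} \<subseteq> S"
    and real: "\<And>x. 0 \<le> x \<Longrightarrow> g (complex_of_real x) = complex_of_real (\<gamma> x)"
    and g0: "g 0 = 0" and dg0: "(g has_field_derivative 0) (at 0)"
    and nz: "\<gamma> x0 \<noteq> 0" "0 \<le> x0"
  shows "\<exists>k c d K. 2 \<le> k \<and> c \<noteq> 0 \<and> 0 < d \<and> (\<forall>x\<in>{0..d}. \<bar>\<gamma> x - c * x ^ k\<bar> \<le> K * x ^ Suc k)"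
proof -
  have "0 \<in> S" using sub by force
  have "\<not> g constant_on S"
    using real[OF nz(2)] nz sub g0 \<open>0 \<in> S\<close> unfolding constant_on_def
    by (metis atLeast_iff image_subset_iff of_real_eq_0_iff)
  then obtain h r k where k: "0 < k" and r: "0 < r" and holh: "h holomorphic_on ball 0 r"
      and gh: "\<And>w. w \<in> ball 0 r \<Longrightarrow> g w = (w - 0) ^ k * h w"
      and hnz: "\<And>w. w \<in> ball 0 r \<Longrightarrow> h w \<noteq> 0"
    using holomorphic_factor_zero_nonconstant[OF hol S \<open>0 \<in> S\<close> g0] by metis
  obtain D where dh: "(h has_field_derivative D) (at 0)"
    using holomorphic_on_imp_differentiable_at[OF holh open_ball, of 0] r
    unfolding field_differentiable_def by auto
  have hlim: "(h \<longlongrightarrow> h 0) (at 0)"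
    using DERIV_isCont[OF dh] by (simp add: isCont_def)
  \<comment> \<open>For a simple zero, \<open>h\<close> would be the difference quotient of
    \<open>g\<close> at \<open>0\<close>, whose limit is \<open>0\<close>.\<close>
  have "k \<noteq> 1"
  proof
    assume "k = 1"
    have "((\<lambda>w. (g w - g 0) / (w - 0)) \<longlongrightarrow> 0) (at 0)"
      using dg0 by (simp add: has_field_derivative_iff)
    moreover have "\<forall>\<^sub>F w in at 0. (g w - g 0) / (w - 0) = h w"
      unfolding eventually_at
      by (rule exI[of _ r]) (use r gh \<open>k = 1\<close> g0 in \<open>auto simp: dist_commute\<close>)
    ultimately have "(h \<longlongrightarrow> 0) (at 0)" by (rule Lim_transform_eventually)
    then show False using hlim hnz[of 0] r tendsto_unique[OF at_neq_bot] by force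
  qed
  with k have k2: "2 \<le> k" by simp
  have hx: "\<gamma> x = x ^ k * Re (h (of_real x)) \<and> x ^ k * Im (h (of_real x)) = 0" if "0 \<le> x" "x < r" for x
  proof -
    have "of_real (\<gamma> x) = of_real (x ^ k) * h (of_real x)"
      using gh[of "of_real x"] real[OF that(1)] that by simp
    then have "Re (of_real (\<gamma> x)) = Re (of_real (x ^ k) * h (of_real x))"
      "Im (of_real (\<gamma> x)) = Im (of_real (x ^ k) * h (of_real x))" by simp_all
    then show ?thesis by (simp del: of_real_power)
  qed
  have "\<forall>\<^sub>F x in at_right 0. Im (h (of_real x)) = 0"
    unfolding eventually_at_right_field
  proof (intro exI[of _ r] conjI allI impI r)
    fix x :: real assume "0 < x" "x < r"
    then show "Im (h (of_real x)) = 0" using hx[of x] by simp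
  qed
  then have "Im (h 0) = 0" by (rule Im_limit_eq_0[OF hlim])
  then have c: "Re (h 0) \<noteq> 0" using hnz[of 0] r by (auto simp: complex_eq_iff)
  \<comment> \<open>A bounded difference quotient of \<open>h\<close> gives an error of order
    \<open>Suc k\<close>, with constant \<open>norm D + 1\<close>.\<close>
  have "((\<lambda>w. (h w - h 0) / (w - 0)) \<longlongrightarrow> D) (at 0)"
    using dh by (simp add: has_field_derivative_iff)
  then have "\<forall>\<^sub>F w in at 0. norm ((h w - h 0) / (w - 0)) < norm D + 1"
    by (rule order_tendstoD(2)[OF tendsto_norm]) simp
  then obtain e where e: "0 < e" "\<And>w. w \<noteq> 0 \<Longrightarrow> norm w < e \<Longrightarrow> norm ((h w - h 0) / (w - 0)) < norm D + 1"
    unfolding eventually_at by auto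
  \<comment> \<open>Halving keeps the closed interval up to \<open>d\<close> inside both open
    discs.\<close>
  define d where "d = min r e / 2"
  have d: "0 < d" "d < r" "d < e" using r e by (auto simp: d_def)
  have "\<bar>\<gamma> x - Re (h 0) * x ^ k\<bar> \<le> (norm D + 1) * x ^ Suc k" if "x \<in> {0..d}" for x
  proof (cases "x = 0")
    case True
    then show ?thesis using hx[of 0] r k by simp
  next
    case False
    with that have x: "0 < x" "x < r" "x < e" using d by auto
    have "norm (h (of_real x) - h 0) / x < norm D + 1"
      using e(2)[of "of_real x"] x by (simp add: norm_divide)
    then have "norm (h (of_real x) - h 0) \<le> (norm D + 1) * x"
      using x by (simp add: field_simps)
    then have "\<bar>Re (h (of_real x)) - Re (h 0)\<bar> \<le> (norm D + 1) * x"
      using abs_Re_le_cmod[of "h (of_real x) - h 0"] by simp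
    then have "x ^ k * \<bar>Re (h (of_real x)) - Re (h 0)\<bar> \<le> x ^ k * ((norm D + 1) * x)"
      using x by (intro mult_left_mono) auto
    moreover have "\<gamma> x - Re (h 0) * x ^ k = x ^ k * (Re (h (of_real x)) - Re (h 0))"
      using hx[of x] x by (simp add: algebra_simps)
    moreover have "\<bar>x ^ k\<bar> = x ^ k" using x by simp
    ultimately show ?thesis
      by (simp only: abs_mult power_Suc mult_ac)
  qed
  with k2 c d(1) show ?thesis
    by (intro exI[of _ k] exI[of _ "Re (h 0)"] exI[of _ d] exI[of _ "norm D + 1"]) simp
qed

text \<open>The parameter \<open>\<mu>\<close> is the logarithmic derivative of \<open>f\<close> at
  \<open>0\<close>. The difference from the exponential then vanishes to second order, so it is
  either identically zero on the half line or has a leading term with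
  \<open>k \<ge> 2\<close>.\<close>

lemma analytic_exponential_or_leading_term:
  assumes f: "complex_analytic_on_nonneg f" and f0: "f 0 > 0"
  obtains \<mu> where "(\<forall>x\<ge>0. f x = f 0 * exp (\<mu> * x)) \<or>
    (\<exists>k c d K. 2 \<le> k \<and> c \<noteq> 0 \<and> 0 < d \<and>
       (\<forall>x\<in>{0..d}. \<bar>f x - f 0 * exp (\<mu> * x) - c * x ^ k\<bar> \<le> K * x ^ Suc k))"
proof -
  obtain U F where U: "open U" "complex_of_real ` {0..} \<subseteq> U" "F holomorphic_on U"
    and F: "\<And>x. 0 \<le> x \<Longrightarrow> F (complex_of_real x) = complex_of_real (f x)"
    using f unfolding complex_analytic_on_nonneg_def by blast
  \<comment> \<open>The given open set may be disconnected; its component at \<open>0\<close> still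
    contains the whole half line.\<close>
  define S where "S = connected_component_set U 0"
  have S: "open S" "connected S" unfolding S_def using U by (auto intro: open_connected_component)
  have "connected (complex_of_real ` {0..})"
    by (intro connected_continuous_image continuous_intros) (auto intro: convex_connected)
  then have sub: "complex_of_real ` {0..} \<subseteq> S"
    unfolding S_def using U by (intro connected_component_maximal) (auto intro!: image_eqI[of _ _ 0])
  have "F holomorphic_on S"
    using U(3) unfolding S_def by (rule holomorphic_on_subset) (rule connected_component_subset)
  moreover have "0 \<in> S" using sub by force
  ultimately obtain D where D: "(F has_field_derivative D) (at 0)"
    using holomorphic_on_imp_differentiable_at[OF _ S(1)] by (auto simp: field_differentiable_def)
  have "((\<lambda>w. (F w - F 0) / (w - 0)) \<longlongrightarrow> D) (at 0)"
    using D by (simp add: has_field_derivative_iff)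
  moreover have "\<forall>\<^sub>F x in at_right 0. Im ((F (complex_of_real x) - F 0) / (complex_of_real x - 0)) = 0"
    using eventually_at_right_less[of "0::real"]
  proof eventually_elim
    case (elim x)
    then have "(F (complex_of_real x) - F 0) / (complex_of_real x - 0) = of_real ((f x - f 0) / x)"
      using F[of x] F[of 0] by simp
    then show ?case by (simp only: Im_complex_of_real)
  qed
  ultimately have "Im D = 0" by (rule Im_limit_eq_0)
  define \<mu> where "\<mu> = Re D / f 0"
  have D\<mu>: "D = of_real (f 0 * \<mu>)"
    using \<open>Im D = 0\<close> f0 by (simp add: complex_eq_iff \<mu>_def)
  define g where "g z = F z - of_real (f 0) * exp (of_real \<mu> * z)" for z
  define \<gamma> where "\<gamma> x = f x - f 0 * exp (\<mu> * x)" for x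
  have real: "g (complex_of_real x) = complex_of_real (\<gamma> x)" if "0 \<le> x" for x
    unfolding g_def \<gamma>_def F[OF that] of_real_mult[symmetric] exp_of_real of_real_diff ..
  have holg: "g holomorphic_on S"
    unfolding g_def using \<open>F holomorphic_on S\<close> by (intro holomorphic_intros)
  have g0: "g 0 = 0" using real[of 0] by (simp add: \<gamma>_def)
  have dg: "(g has_field_derivative 0) (at 0)"
    unfolding g_def[abs_def]
    by (rule derivative_eq_intros D refl)+ (simp add: D\<mu>)
  show thesis
  proof (rule that[of \<mu>], rule disjCI)
    assume *: "\<not> (\<exists>k c d K. 2 \<le> k \<and> c \<noteq> 0 \<and> 0 < d \<and>
       (\<forall>x\<in>{0..d}. \<bar>f x - f 0 * exp (\<mu> * x) - c * x ^ k\<bar> \<le> K * x ^ Suc k))"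
    have \<gamma>0: "\<gamma> x = 0" if "0 \<le> x" for x
    proof (rule ccontr)
      assume "\<gamma> x \<noteq> 0"
      from holomorphic_nonneg_real_leading_term[where g = g and \<gamma> = \<gamma> and ?x0.0 = x, OF S holg sub real g0 dg this that]
      show False using * unfolding \<gamma>_def by (rule notE[rotated])
    qed
    show "\<forall>x\<ge>0. f x = f 0 * exp (\<mu> * x)"
    proof (intro allI impI)
      fix x :: real assume "0 \<le> x"
      from \<gamma>0[OF this] show "f x = f 0 * exp (\<mu> * x)"
        unfolding \<gamma>_def by (simp only: right_minus_eq)
    qed
  qed
qed

section \<open>Integrals and bounds for the exponential model\<close>

lemma abs_exp_minus_1_le: "\<bar>exp z - 1\<bar> \<le> \<bar>z\<bar> * exp \<bar>z\<bar>" for z :: real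
proof (cases "0 \<le> z")
  case True
  \<comment> \<open>Here \<open>1 - z \<le> exp (- z)\<close> is multiplied by \<open>exp z\<close>,
    so the right side is 1.\<close>
  have "exp z * (1 - z) \<le> exp z * exp (- z)"
    using exp_ge_add_one_self[of "- z"] by (intro mult_left_mono) auto
  then show ?thesis using True by (simp add: exp_minus algebra_simps)
next
  case False
  have "1 + z \<le> exp z" by (rule exp_ge_add_one_self)
  moreover have "exp z \<le> 1" using False by simp
  ultimately have "\<bar>exp z - 1\<bar> \<le> \<bar>z\<bar> * 1" using False by linarith
  also have "\<dots> \<le> \<bar>z\<bar> * exp \<bar>z\<bar>" by (intro mult_left_mono) auto
  finally show ?thesis .
qed

lemma has_integral_exp_model:
  fixes H :: "real \<Rightarrow> real"
  assumes "\<And>x. (H has_real_derivative a * exp (\<mu> * x)) (at x)" "H 0 = 0" "0 \<le> x"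
  shows "((\<lambda>y. a * exp (\<mu> * y)) has_integral H x) {0..x}"
  using fundamental_theorem_of_calculus[OF assms(3), of H "\<lambda>y. a * exp (\<mu> * y)"] assms(1,2)
  by (auto simp: has_real_derivative_iff_has_vector_derivative[symmetric] intro: DERIV_subset)

lemma has_integral_monom:
  assumes "0 \<le> x"
  shows "((\<lambda>y. c * y ^ k) has_integral c / real (Suc k) * x ^ Suc k) {0..x}"
proof -
  have "((\<lambda>y. c / real (Suc k) * y ^ Suc k) has_real_derivative c * y ^ k) (at y within {0..x})" for y
    by (rule derivative_eq_intros refl)+ (simp add: field_simps)
  then show ?thesis
    using fundamental_theorem_of_calculus[OF assms, of "\<lambda>y. c / real (Suc k) * y ^ Suc k" "\<lambda>y. c * y ^ k"]
    by (auto simp: has_real_derivative_iff_has_vector_derivative[symmetric])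
qed

lemma has_integral_interval_bound:
  fixes u :: "real \<Rightarrow> real"
  assumes "(u has_integral I) {0..x}" "0 \<le> x" "0 \<le> K" "\<And>y. 0 \<le> y \<Longrightarrow> y \<le> x \<Longrightarrow> \<bar>u y\<bar> \<le> K"
  shows "\<bar>I\<bar> \<le> K * x"
  using has_integral_bound_real[OF assms(3) finite.emptyI assms(1)] assms(2,4) by auto

text \<open>\<open>H x - a * x\<close> is the integral of \<open>a * (exp (\<mu> * y) - 1)\<close>,
  which is of first order in \<open>y\<close>; integrating gains the second order.\<close>

lemma lead_exp_model:
  assumes dH: "\<And>x. (H has_real_derivative a * exp (\<mu> * x)) (at x)" and H0: "H 0 = 0"
  shows "lead 1 a H"
  unfolding lead_def
proof (rule exp_O_I[where C = "\<bar>a\<bar> * \<bar>\<mu>\<bar>" and B = "\<bar>\<mu>\<bar>"])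
  have "continuous_on UNIV H"
    using DERIV_isCont[OF dH] by (simp add: continuous_at_imp_continuous_on)
  then show "(\<lambda>x. H x - a * x ^ 1) \<in> borel_measurable borel"
    by (intro borel_measurable_continuous_onI continuous_intros)
  fix x :: real assume x: "0 \<le> x"
  have "((\<lambda>y. a * exp (\<mu> * y) - a * y ^ 0) has_integral H x - a / real (Suc 0) * x ^ Suc 0) {0..x}"
    by (intro has_integral_diff has_integral_exp_model[OF dH H0] has_integral_monom x)
  then have "\<bar>H x - a / real (Suc 0) * x ^ Suc 0\<bar> \<le> (\<bar>a\<bar> * (\<bar>\<mu>\<bar> * x * exp (\<bar>\<mu>\<bar> * x))) * x"
  proof (rule has_integral_interval_bound)
    fix y assume y: "0 \<le> y" "y \<le> x"
    have "\<bar>exp (\<mu> * y) - 1\<bar> \<le> \<bar>\<mu>\<bar> * y * exp (\<bar>\<mu>\<bar> * y)"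
      using abs_exp_minus_1_le[of "\<mu> * y"] y by (simp add: abs_mult)
    also have "\<dots> \<le> \<bar>\<mu>\<bar> * x * exp (\<bar>\<mu>\<bar> * x)"
      using y by (intro mult_mono) (auto intro: mult_left_mono)
    finally have "\<bar>a\<bar> * \<bar>exp (\<mu> * y) - 1\<bar> \<le> \<bar>a\<bar> * (\<bar>\<mu>\<bar> * x * exp (\<bar>\<mu>\<bar> * x))"
      by (intro mult_left_mono) auto
    then show "\<bar>a * exp (\<mu> * y) - a * y ^ 0\<bar> \<le> \<bar>a\<bar> * (\<bar>\<mu>\<bar> * x * exp (\<bar>\<mu>\<bar> * x))"
      by (simp add: abs_mult[symmetric] algebra_simps)
  qed (use x in auto)
  then show "\<bar>H x - a * x ^ 1\<bar> \<le> \<bar>a\<bar> * \<bar>\<mu>\<bar> * x ^ Suc 1 * exp (\<bar>\<mu>\<bar> * x)"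
    by (simp add: algebra_simps)
qed

text \<open>The analytic core, free of random variables: \<open>\<Phi>\<close> enters as a bounded
  primitive of \<open>f\<close> with limit 1 that solves the transformed equation.\<close>

lemma exponential_of_cdf_equation:
  fixes f \<Phi> :: "real \<Rightarrow> real"
  assumes f: "complex_analytic_on_nonneg f" and f0: "f 0 > 0"
    and \<Phi>m: "\<Phi> \<in> borel_measurable borel" and \<Phi>b: "\<And>x. \<bar>\<Phi> x\<bar> \<le> 1"
    and \<Phi>lim: "(\<Phi> \<longlongrightarrow> 1) at_top"
    and \<Phi>i: "\<And>x. 0 \<le> x \<Longrightarrow> (f has_integral \<Phi> x) {0..x}"
    and mn: "1 \<le> m" "m < n"
    and eq: "eventually (\<lambda>t. laplace (\<lambda>x. \<Phi> x ^ n) t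
       = laplace (\<lambda>x. \<Phi> x ^ m) t * (\<Prod>i=m+1..n. t / real i * laplace \<Phi> (t / real i))) at_top"
    and x: "0 \<le> x"
  shows "f x = f 0 * exp (- f 0 * x)"
proof -
  define a where "a = f 0"
  have a: "0 < a" using f0 by (simp add: a_def)
  obtain \<mu> where \<mu>: "(\<forall>x\<ge>0. f x = a * exp (\<mu> * x)) \<or>
    (\<exists>k c d K. 2 \<le> k \<and> c \<noteq> 0 \<and> 0 < d \<and>
       (\<forall>x\<in>{0..d}. \<bar>f x - a * exp (\<mu> * x) - c * x ^ k\<bar> \<le> K * x ^ Suc k))"
    unfolding a_def by (rule analytic_exponential_or_leading_term[OF f f0])
  \<comment> \<open>For \<open>\<mu> = 0\<close> the closed form would be the zero function, as
    division by \<open>0\<close> yields \<open>0\<close>; the linear primitive replaces it.\<close>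
  define H where "H x = (if \<mu> = 0 then a * x else a / \<mu> * (exp (\<mu> * x) - 1))" for x
  have dH: "(H has_real_derivative a * exp (\<mu> * x)) (at x)" for x
  proof (cases "\<mu> = 0")
    case True
    then show ?thesis unfolding H_def[abs_def] by (auto intro!: derivative_eq_intros)
  next
    case False
    then show ?thesis unfolding H_def[abs_def] by (auto intro!: derivative_eq_intros)
  qed
  have H0: "H 0 = 0" by (simp add: H_def)
  have dH': "(H has_real_derivative a + \<mu> * H x) (at x)" for x
  proof -
    have "a + \<mu> * H x = a * exp (\<mu> * x)" by (simp add: H_def algebra_simps)
    then show ?thesis using dH[of x] by simp
  qed
  have lH: "lead 1 a H" by (rule lead_exp_model[OF dH H0])
  have \<Phi>O: "\<Phi> \<in> exp_O 0" by (rule exp_O_I[where C = 1 and B = 0]) (use \<Phi>m \<Phi>b in auto)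
  have fexp: "f y = a * exp (\<mu> * y)" if "0 \<le> y" for y
  proof (rule ccontr)
    assume "f y \<noteq> a * exp (\<mu> * y)"
    with \<mu> that obtain k c d K where k: "2 \<le> k" and c: "c \<noteq> 0" and d: "0 < d"
      and K: "\<And>x. x \<in> {0..d} \<Longrightarrow> \<bar>f x - a * exp (\<mu> * x) - c * x ^ k\<bar> \<le> K * x ^ Suc k"
      by blast
    \<comment> \<open>Integration turns the term \<open>c * x ^ k\<close> of the density into
      \<open>?c * x ^ Suc k\<close> of the distribution function.\<close>
    let ?c = "c / real (Suc k)"
    have D: "lead (Suc k) ?c (\<lambda>x. \<Phi> x - H x)"
      unfolding lead_def
    proof (rule exp_O_of_local[OF _ d])
      have "(\<lambda>x. \<Phi> x + (- 1) * H x + (- ?c) * x ^ Suc k) \<in> exp_O 0"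
        using \<Phi>O exp_O_mono[OF lead_imp_exp_O[OF lH]] exp_O_mono[OF exp_O_monom[of "- ?c" "Suc k"]]
        by (intro exp_O_add exp_O_cmult[of H]) auto
      then show "(\<lambda>x. \<Phi> x - H x - ?c * x ^ Suc k) \<in> exp_O 0" by simp
      fix x assume x: "0 \<le> x" "x \<le> d"
      have "((\<lambda>y. f y - a * exp (\<mu> * y) - c * y ^ k) has_integral \<Phi> x - H x - ?c * x ^ Suc k) {0..x}"
        by (intro has_integral_diff \<Phi>i has_integral_exp_model[OF dH H0] has_integral_monom x)
      then have "\<bar>\<Phi> x - H x - ?c * x ^ Suc k\<bar> \<le> (\<bar>K\<bar> * x ^ Suc k) * x"
      proof (rule has_integral_interval_bound)
        fix y assume y: "0 \<le> y" "y \<le> x"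
        have "\<bar>f y - a * exp (\<mu> * y) - c * y ^ k\<bar> \<le> K * y ^ Suc k" using K y x by auto
        also have "\<dots> \<le> \<bar>K\<bar> * x ^ Suc k" using y by (intro mult_mono power_mono) auto
        finally show "\<bar>f y - a * exp (\<mu> * y) - c * y ^ k\<bar> \<le> \<bar>K\<bar> * x ^ Suc k" .
      qed (use x in auto)
      then show "\<bar>\<Phi> x - H x - ?c * x ^ Suc k\<bar> \<le> \<bar>K\<bar> * x ^ Suc (Suc k)"
        by (simp add: mult_ac)
    qed
    \<comment> \<open>\<open>\<Phi>\<close> inherits its linear term from \<open>H\<close>, since
      their difference vanishes to order \<open>Suc k\<close>.\<close>
    have "(\<lambda>x. (\<Phi> x - H x) + (H x - a * x ^ 1)) \<in> exp_O (Suc 1)"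
      using lead_imp_exp_O[OF D] lH k unfolding lead_def
      by (intro exp_O_add) (auto elim: exp_O_mono)
    then have "lead 1 a \<Phi>" by (simp add: lead_def)
    from coefficient_eq_0[OF mn k a this lH D dH' eq] c show False by simp
  qed
  have \<Phi>H: "\<Phi> y = H y" if "0 \<le> y" for y
  proof -
    have "(f has_integral H y) {0..y}"
      using has_integral_exp_model[OF dH H0 that] by (rule has_integral_eq[rotated]) (simp add: fexp)
    then show ?thesis using \<Phi>i[OF that] by (rule has_integral_unique[rotated])
  qed
  \<comment> \<open>Otherwise the density is at least \<open>a\<close> on the half line, so
    \<open>\<Phi>\<close> would reach 2 by the point \<open>2 / a\<close>.\<close>
  have "\<mu> < 0"
  proof (rule ccontr)
    assume "\<not> \<mu> < 0"
    have I: "((\<lambda>y. a * exp (\<mu> * y) - a * y ^ 0) has_integral H (2 / a) - a / real (Suc 0) * (2 / a) ^ Suc 0) {0..2 / a}"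
      using a by (intro has_integral_diff has_integral_exp_model[OF dH H0] has_integral_monom) auto
    have "0 \<le> H (2 / a) - a / real (Suc 0) * (2 / a) ^ Suc 0"
      by (rule has_integral_nonneg[OF I]) (use a \<open>\<not> \<mu> < 0\<close> in auto)
    then have "2 \<le> \<Phi> (2 / a)" using a \<Phi>H[of "2 / a"] by simp
    then show False using \<Phi>b[of "2 / a"] by simp
  qed
  have "((\<lambda>y. exp (\<mu> * y)) \<longlongrightarrow> 0) at_top" using \<open>\<mu> < 0\<close> by real_asymp
  then have "((\<lambda>y. a / \<mu> * (exp (\<mu> * y) - 1)) \<longlongrightarrow> a / \<mu> * (0 - 1)) at_top"
    by (intro tendsto_intros)
  moreover have "eventually (\<lambda>y. \<Phi> y = a / \<mu> * (exp (\<mu> * y) - 1)) at_top"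
    using eventually_ge_at_top[of "0::real"] by eventually_elim (use \<open>\<mu> < 0\<close> in \<open>simp add: \<Phi>H H_def\<close>)
  ultimately have "(\<Phi> \<longlongrightarrow> a / \<mu> * (0 - 1)) at_top"
    by (simp only: tendsto_cong)
  \<comment> \<open>Total mass 1 determines \<open>\<mu>\<close>.\<close>
  then have "a / \<mu> * (0 - 1) = 1"
    using \<Phi>lim by (rule tendsto_unique[OF trivial_limit_at_top_linorder])
  then have "\<mu> = - a" using \<open>\<mu> < 0\<close> by (simp add: field_simps)
  then show ?thesis using fexp[OF x] by (simp add: a_def)
qed

section \<open>Laplace transforms of maxima\<close>

text \<open>Write \<open>exp (- t * y)\<close> as the integral of \<open>t * exp (- t * x)\<close>
  over \<open>x \<ge> y\<close> and exchange the integrals. Nonnegative integrals avoid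
  integrability questions, and \<open>Y\<close> may lack a density.\<close>

lemma (in prob_space) expectation_exp_eq_laplace:
  assumes Y[measurable]: "Y \<in> borel_measurable M" and nn: "AE \<omega> in M. 0 \<le> Y \<omega>" and t: "0 < t"
  shows "expectation (\<lambda>\<omega>. exp (- t * Y \<omega>)) = t * laplace (\<lambda>x. prob {\<omega> \<in> space M. Y \<omega> \<le> x}) t"
proof -
  interpret pair_sigma_finite M lborel ..
  define \<Phi> where "\<Phi> x = prob {\<omega> \<in> space M. Y \<omega> \<le> x}" for x
  have mono: "mono \<Phi>"
    unfolding \<Phi>_def by (intro monoI finite_measure_mono) auto
  have [measurable]: "\<Phi> \<in> borel_measurable borel" using mono by (rule borel_measurable_mono)
  have inner: "(\<integral>\<^sup>+x. ennreal (t * exp (- t * x)) * indicator {y..} x \<partial>lborel) = ennreal (exp (- t * y))" for y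
  proof -
    have "((\<lambda>x. - exp (- t * x)) \<longlongrightarrow> - 0) at_top" using t by (intro tendsto_minus) real_asymp
    then have "(\<integral>\<^sup>+x. ennreal (t * exp (- t * x)) * indicator {y..} x \<partial>lborel) = 0 - (- exp (- t * y))"
      using t by (intro nn_integral_FTC_atLeast[where F = "\<lambda>x. - exp (- t * x)"])
        (auto intro!: derivative_eq_intros)
    then show ?thesis by simp
  qed
  have nnL: "(\<integral>\<^sup>+\<omega>. ennreal (exp (- t * Y \<omega>)) \<partial>M)
      = (\<integral>\<^sup>+x. ennreal (t * (indicator {0..} x * (exp (- t * x) * \<Phi> x))) \<partial>lborel)"
  proof -
    have "(\<integral>\<^sup>+\<omega>. ennreal (exp (- t * Y \<omega>)) \<partial>M)
        = (\<integral>\<^sup>+\<omega>. (\<integral>\<^sup>+x. ennreal (t * exp (- t * x)) * indicator {Y \<omega>..} x \<partial>lborel) \<partial>M)"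
      by (simp only: inner)
    \<comment> \<open>Almost sure nonnegativity of \<open>Y\<close> allows the region
      \<open>Y \<omega> \<le> x\<close> to be cut down to \<open>x \<ge> 0\<close>.\<close>
    also have "\<dots> = (\<integral>\<^sup>+\<omega>. (\<integral>\<^sup>+x. ennreal (t * exp (- t * x)) * indicator {0..} x *
        indicator {\<omega> \<in> space M. Y \<omega> \<le> x} \<omega> \<partial>lborel) \<partial>M)"
    proof (rule nn_integral_cong_AE)
      show "AE \<omega> in M. (\<integral>\<^sup>+x. ennreal (t * exp (- t * x)) * indicator {Y \<omega>..} x \<partial>lborel)
        = (\<integral>\<^sup>+x. ennreal (t * exp (- t * x)) * indicator {0..} x *
            indicator {\<omega> \<in> space M. Y \<omega> \<le> x} \<omega> \<partial>lborel)"
        using nn AE_space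
        by eventually_elim (intro nn_integral_cong, auto split: split_indicator)
    qed
    also have "\<dots> = (\<integral>\<^sup>+x. (\<integral>\<^sup>+\<omega>. ennreal (t * exp (- t * x)) * indicator {0..} x *
        indicator {\<omega> \<in> space M. Y \<omega> \<le> x} \<omega> \<partial>M) \<partial>lborel)"
      by (rule Fubini'[symmetric]) (simp add: indicator_def, measurable)
    also have "\<dots> = (\<integral>\<^sup>+x. ennreal (t * exp (- t * x)) * indicator {0..} x * ennreal (\<Phi> x) \<partial>lborel)"
      by (intro nn_integral_cong) (simp add: nn_integral_cmult emeasure_eq_measure \<Phi>_def)
    also have "\<dots> = (\<integral>\<^sup>+x. ennreal (t * (indicator {0..} x * (exp (- t * x) * \<Phi> x))) \<partial>lborel)"
      using t by (intro nn_integral_cong)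
        (auto split: split_indicator simp: ennreal_mult'[symmetric] \<Phi>_def mult_ac)
    finally show ?thesis .
  qed
  have "expectation (\<lambda>\<omega>. exp (- t * Y \<omega>)) = enn2real (\<integral>\<^sup>+\<omega>. ennreal (exp (- t * Y \<omega>)) \<partial>M)"
    by (intro integral_eq_nn_integral) auto
  also have "\<dots> = (\<integral>x. t * (indicator {0..} x * (exp (- t * x) * \<Phi> x)) \<partial>lborel)"
    unfolding nnL using t by (intro integral_eq_nn_integral[symmetric]) (auto simp: \<Phi>_def)
  also have "\<dots> = t * laplace \<Phi> t"
    by (simp add: laplace_def set_lebesgue_integral_def)
  finally show ?thesis by (simp add: \<Phi>_def[abs_def])
qed

lemma (in prob_space) prob_Max_le:
  fixes Xs :: "nat \<Rightarrow> 'a \<Rightarrow> real"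
  assumes ind: "indep_vars (\<lambda>_. borel) Xs I" and J: "J \<subseteq> I" "finite J" "J \<noteq> {}"
    and P: "\<And>i. i \<in> J \<Longrightarrow> prob {\<omega> \<in> space M. Xs i \<omega> \<le> x} = p"
  shows "prob {\<omega> \<in> space M. (MAX i\<in>J. Xs i \<omega>) \<le> x} = p ^ card J"
proof -
  have "{\<omega> \<in> space M. (MAX i\<in>J. Xs i \<omega>) \<le> x} = (\<Inter>i\<in>J. Xs i -` {..x} \<inter> space M)"
    using J by auto
  also have "prob \<dots> = (\<Prod>i\<in>J. prob (Xs i -` {..x} \<inter> space M))"
    using J by (intro indep_varsD[OF ind]) auto
  also have "\<dots> = (\<Prod>i\<in>J. p)"
  proof (rule prod.cong[OF refl])
    fix i assume "i \<in> J"
    have "Xs i -` {..x} \<inter> space M = {\<omega> \<in> space M. Xs i \<omega> \<le> x}" by auto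
    then show "prob (Xs i -` {..x} \<inter> space M) = p" using P[OF \<open>i \<in> J\<close>] by simp
  qed
  finally show ?thesis by simp
qed

text \<open>The maximum and the sum depend on disjoint families of independent variables, so the
  expectation factors; the sum factors further. Nonnegativity bounds every exponential by 1, which
  gives integrability.\<close>

lemma (in prob_space) expectation_exp_Max_add_sum:
  fixes Xs :: "nat \<Rightarrow> 'a \<Rightarrow> real" and c :: "nat \<Rightarrow> real"
  assumes ind: "indep_vars (\<lambda>_. borel) Xs (J \<union> K)" and fin: "finite J" "finite K" "J \<noteq> {}" "J \<inter> K = {}"
    and nn: "\<And>i. i \<in> J \<union> K \<Longrightarrow> AE \<omega> in M. 0 \<le> Xs i \<omega>" and t: "0 < t" and c: "\<And>i. i \<in> K \<Longrightarrow> 0 \<le> c i"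
  shows "expectation (\<lambda>\<omega>. exp (- t * ((MAX i\<in>J. Xs i \<omega>) + (\<Sum>i\<in>K. c i * Xs i \<omega>))))
    = expectation (\<lambda>\<omega>. exp (- t * (MAX i\<in>J. Xs i \<omega>))) * (\<Prod>i\<in>K. expectation (\<lambda>\<omega>. exp (- (t * c i) * Xs i \<omega>)))"
proof -
  have m: "random_variable borel (Xs i)" if "i \<in> J \<union> K" for i
    using ind that by (auto simp: indep_vars_def)
  have int: "integrable M (\<lambda>\<omega>. exp (- Y \<omega>))"
    if "random_variable borel Y" "AE \<omega> in M. 0 \<le> Y \<omega>" for Y :: "'a \<Rightarrow> real"
    using that by (intro integrable_const_bound[where B = 1]) auto
  have mMax: "random_variable borel (\<lambda>\<omega>. MAX i\<in>J. Xs i \<omega>)"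
    using fin m by (intro borel_measurable_Max) auto
  have nnMax: "AE \<omega> in M. 0 \<le> (MAX i\<in>J. Xs i \<omega>)"
  proof -
    obtain j where "j \<in> J" using fin by auto
    then have "AE \<omega> in M. 0 \<le> Xs j \<omega>" using nn by auto
    then show ?thesis
    proof eventually_elim
      case (elim \<omega>)
      also have "Xs j \<omega> \<le> (MAX i\<in>J. Xs i \<omega>)" using \<open>j \<in> J\<close> fin by (intro Max_ge) auto
      finally show ?case .
    qed
  qed
  have nnS: "AE \<omega> in M. 0 \<le> (\<Sum>i\<in>K. c i * Xs i \<omega>)"
  proof -
    have "AE \<omega> in M. \<forall>i\<in>K. 0 \<le> Xs i \<omega>" using nn fin by (intro AE_finite_allI) auto
    then show ?thesis by eventually_elim (auto intro!: sum_nonneg mult_nonneg_nonneg c)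
  qed
  have mS: "random_variable borel (\<lambda>\<omega>. \<Sum>i\<in>K. c i * Xs i \<omega>)"
    using m by (intro borel_measurable_sum borel_measurable_times) auto
  let ?A = "\<lambda>\<omega>. exp (- (t * (MAX i\<in>J. Xs i \<omega>)))" and ?B = "\<lambda>\<omega>. exp (- (t * (\<Sum>i\<in>K. c i * Xs i \<omega>)))"
  have iA: "integrable M ?A"
    using mMax nnMax t by (intro int) (auto elim!: eventually_mono)
  have iB: "integrable M ?B"
    using mS nnS t by (intro int) (auto elim!: eventually_mono)
  \<comment> \<open>Each factor is a measurable function of a restricted tuple; the restrictions to
    the disjoint sets \<open>J\<close> and \<open>K\<close> are independent.\<close>
  have "indep_var borel ((\<lambda>f. exp (- (t * (MAX i\<in>J. f i)))) \<circ> (\<lambda>\<omega>. restrict (\<lambda>i. Xs i \<omega>) J))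
     borel ((\<lambda>f. exp (- (t * (\<Sum>i\<in>K. c i * f i)))) \<circ> (\<lambda>\<omega>. restrict (\<lambda>i. Xs i \<omega>) K))"
  proof (rule indep_var_compose[OF indep_var_restrict[OF ind]])
    have "(\<lambda>f. MAX i\<in>J. f i) \<in> borel_measurable (Pi\<^sub>M J (\<lambda>_. borel :: real measure))"
      using fin by (intro borel_measurable_Max) auto
    then show "(\<lambda>f. exp (- (t * (MAX i\<in>J. f i)))) \<in> borel_measurable (Pi\<^sub>M J (\<lambda>_. borel :: real measure))"
      by measurable
  qed (use fin in auto)
  moreover have "(\<lambda>f. exp (- (t * (MAX i\<in>J. f i)))) \<circ> (\<lambda>\<omega>. restrict (\<lambda>i. Xs i \<omega>) J) = ?A"
    by (auto simp: fun_eq_iff cong: image_cong)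
  moreover have "(\<lambda>f. exp (- (t * (\<Sum>i\<in>K. c i * f i)))) \<circ> (\<lambda>\<omega>. restrict (\<lambda>i. Xs i \<omega>) K) = ?B"
    by (auto simp: fun_eq_iff cong: sum.cong)
  ultimately have iv: "indep_var borel ?A borel ?B" by simp
  have "indep_vars (\<lambda>_. borel) (\<lambda>i \<omega>. exp (- (t * c i) * Xs i \<omega>)) K"
    by (rule indep_vars_compose2[OF indep_vars_subset[OF ind], of K "\<lambda>i x. exp (- (t * c i) * x)"]) auto
  moreover have "integrable M (\<lambda>\<omega>. exp (- (t * c i) * Xs i \<omega>))" if "i \<in> K" for i
  proof -
    have "AE \<omega> in M. 0 \<le> Xs i \<omega>" using nn that by simp
    then have "AE \<omega> in M. 0 \<le> t * c i * Xs i \<omega>"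
      by eventually_elim (use t c[OF that] in auto)
    then show ?thesis using int[of "\<lambda>\<omega>. t * c i * Xs i \<omega>"] m[of i] that by simp
  qed
  ultimately have "expectation (\<lambda>\<omega>. \<Prod>i\<in>K. exp (- (t * c i) * Xs i \<omega>))
      = (\<Prod>i\<in>K. expectation (\<lambda>\<omega>. exp (- (t * c i) * Xs i \<omega>)))"
    by (intro indep_vars_lebesgue_integral fin) auto
  moreover have "?B = (\<lambda>\<omega>. \<Prod>i\<in>K. exp (- (t * c i) * Xs i \<omega>))"
    using fin by (simp add: fun_eq_iff sum_distrib_left sum_negf[symmetric] mult.assoc exp_sum)
  ultimately have B: "expectation ?B = (\<Prod>i\<in>K. expectation (\<lambda>\<omega>. exp (- (t * c i) * Xs i \<omega>)))"
    by simp
  have "(\<lambda>\<omega>. exp (- t * ((MAX i\<in>J. Xs i \<omega>) + (\<Sum>i\<in>K. c i * Xs i \<omega>)))) = (\<lambda>\<omega>. ?A \<omega> * ?B \<omega>)"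
    by (simp add: fun_eq_iff algebra_simps flip: exp_add)
  then show ?thesis
    using indep_var_lebesgue_integral[OF iv iA iB] B by simp
qed

section \<open>From equality in distribution to the equation for Laplace transforms\<close>

theorem mainTheorem1:
  fixes N :: "'b measure" and X :: "'b \<Rightarrow> real" and f :: "real \<Rightarrow> real"
    and M :: "'a measure" and Xs :: "nat \<Rightarrow> 'a \<Rightarrow> real" and n s :: nat
  assumes "prob_space N"
    and "AE \<omega> in N. 0 \<le> X \<omega>"
    and "distributed N lborel X (\<lambda>x. ennreal (f x))"
    and "\<And>x. 0 \<le> f x"
    and "\<And>x. x < 0 \<Longrightarrow> f x = 0"
    and "complex_analytic_on_nonneg f"
    and "f 0 > 0"
    and "1 \<le> s" and "s \<le> n - 1"
    and "prob_space M"
    and "prob_space.indep_vars M (\<lambda>_. borel) Xs {1..n}"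
    and "\<And>i. i \<in> {1..n} \<Longrightarrow> eq_in_distribution M (Xs i) N X"
    and "eq_in_distribution
           M (\<lambda>\<omega>. (MAX i\<in>{1..n - s}. Xs i \<omega>) + (\<Sum>i = n - s + 1..n. (1 / real i) * Xs i \<omega>))
           M (\<lambda>\<omega>. MAX i\<in>{1..n}. Xs i \<omega>)"
  shows "\<exists>l>0. distributed N lborel X (\<lambda>x. ennreal (exponential_density l x)) \<and>
                 (\<forall>x\<ge>0. f x = l * exp (- l * x))"
proof -
  interpret N: prob_space N by fact
  interpret M: prob_space M by fact
  let ?D = "distr N borel X"
  have X [measurable]: "X \<in> borel_measurable N"
    using distributed_measurable[OF assms(3)] by simp
  have fm: "f \<in> borel_measurable borel"
  proof -
    have "(\<lambda>x. ennreal (f x)) \<in> borel_measurable borel"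
      using distributed_borel_measurable[OF assms(3)] by simp
    then have "(\<lambda>x. enn2real (ennreal (f x))) \<in> borel_measurable borel" by measurable
    then show ?thesis using assms(4) by simp
  qed
  interpret D: prob_space ?D by (intro N.prob_space_distr X)
  interpret D: real_distribution ?D by unfold_locales auto
  define \<Phi> where "\<Phi> = cdf ?D"
  have \<Phi>m: "\<Phi> \<in> borel_measurable borel"
    unfolding \<Phi>_def by (intro borel_measurable_mono monoI D.cdf_nondecreasing)
  have \<Phi>b: "\<bar>\<Phi> x\<bar> \<le> 1" for x
    unfolding \<Phi>_def using D.cdf_nonneg[of x] D.cdf_bounded_prob[of x] by simp
  have \<Phi>lim: "(\<Phi> \<longlongrightarrow> 1) at_top"
    unfolding \<Phi>_def by (rule D.cdf_lim_at_top_prob)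
  \<comment> \<open>As \<open>f\<close> vanishes on the negative axis, the mass of
    \<open>{..x}\<close> is an integral over \<open>{0..x}\<close> only.\<close>
  have \<Phi>i: "(f has_integral \<Phi> x) {0..x}" if "0 \<le> x" for x
  proof -
    have "ennreal (\<Phi> x) = emeasure (distr N lborel X) {..x}"
      unfolding \<Phi>_def cdf_def by (simp add: D.emeasure_eq_measure[symmetric] emeasure_distr)
    also have "\<dots> = (\<integral>\<^sup>+y. ennreal (f y) * indicator {..x} y \<partial>lborel)"
      unfolding distributed_distr_eq_density[OF assms(3)] using fm by (subst emeasure_density) auto
    also have "\<dots> = (\<integral>\<^sup>+y. ennreal (if y \<in> {0..x} then f y else 0) \<partial>lborel)"
      using assms(5) by (intro nn_integral_cong) (auto split: split_indicator)
    finally have "((\<lambda>y. if y \<in> {0..x} then f y else 0) has_integral \<Phi> x) UNIV"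
      using assms(4) fm D.cdf_nonneg[of x] by (intro nn_integral_has_integral) (auto simp: \<Phi>_def)
    then show ?thesis by (simp only: has_integral_restrict_UNIV)
  qed
  let ?m = "n - s"
  have mn: "1 \<le> ?m" "?m < n" using assms(8,9) by auto
  have un: "{1..n} = {1..?m} \<union> {?m + 1..n}" using mn by auto
  note eqd = assms(12)[unfolded eq_in_distribution_def]
  have Xm: "Xs i \<in> borel_measurable M" if "i \<in> {1..n}" for i using eqd[OF that] by simp
  have Xnn: "AE \<omega> in M. 0 \<le> Xs i \<omega>" if "i \<in> {1..n}" for i
  proof -
    \<comment> \<open>Nonnegativity is a property of the law, so it passes from \<open>X\<close> to
      every \<open>Xs i\<close>.\<close>
    have "AE x in ?D. 0 \<le> x" using assms(2) by (subst AE_distr_iff) auto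
    then have "AE x in distr M borel (Xs i). 0 \<le> x"
      using eqd[OF that] by (simp only:)
    then show ?thesis using Xm[OF that] by (subst (asm) AE_distr_iff) auto
  qed
  have XP: "M.prob {\<omega> \<in> space M. Xs i \<omega> \<le> x} = \<Phi> x" if "i \<in> {1..n}" for i x
  proof -
    have "M.prob {\<omega> \<in> space M. Xs i \<omega> \<le> x} = measure (distr M borel (Xs i)) {..x}"
      using Xm[OF that] by (subst measure_distr) (auto intro!: arg_cong[of _ _ M.prob])
    then show ?thesis using eqd[OF that] by (simp add: \<Phi>_def cdf_def)
  qed
  have EX: "M.expectation (\<lambda>\<omega>. exp (- t * Xs i \<omega>)) = t * laplace \<Phi> t" if "i \<in> {1..n}" "0 < t" for i t
    using M.expectation_exp_eq_laplace[OF Xm Xnn that(2)] that(1) XP[OF that(1)] by simp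
  have EMax: "M.expectation (\<lambda>\<omega>. exp (- t * (MAX i\<in>{1..j}. Xs i \<omega>))) = t * laplace (\<lambda>x. \<Phi> x ^ j) t"
    if j: "1 \<le> j" "j \<le> n" and t: "0 < t" for j t
  proof -
    have m: "(\<lambda>\<omega>. MAX i\<in>{1..j}. Xs i \<omega>) \<in> borel_measurable M"
      using j Xm by (intro borel_measurable_Max) auto
    have "AE \<omega> in M. 0 \<le> Xs 1 \<omega>" using j by (intro Xnn) auto
    then have "AE \<omega> in M. 0 \<le> (MAX i\<in>{1..j}. Xs i \<omega>)"
    proof eventually_elim
      case (elim \<omega>)
      also have "Xs 1 \<omega> \<le> (MAX i\<in>{1..j}. Xs i \<omega>)" using j by (intro Max_ge) auto
      finally show ?case .
    qed
    moreover have "M.prob {\<omega> \<in> space M. (MAX i\<in>{1..j}. Xs i \<omega>) \<le> x} = \<Phi> x ^ j" for x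
      using M.prob_Max_le[OF assms(11), of "{1..j}" x "\<Phi> x"] j XP by simp
    ultimately show ?thesis
      using M.expectation_exp_eq_laplace[OF m _ t] by simp
  qed
  have eq: "laplace (\<lambda>x. \<Phi> x ^ n) t
      = laplace (\<lambda>x. \<Phi> x ^ ?m) t * (\<Prod>i=?m+1..n. t / real i * laplace \<Phi> (t / real i))" if t: "0 < t" for t
  proof -
    let ?S = "\<lambda>\<omega>. (MAX i\<in>{1..?m}. Xs i \<omega>) + (\<Sum>i = ?m + 1..n. (1 / real i) * Xs i \<omega>)"
    let ?T = "\<lambda>\<omega>. MAX i\<in>{1..n}. Xs i \<omega>"
    have ST: "?S \<in> borel_measurable M" "?T \<in> borel_measurable M" "distr M borel ?S = distr M borel ?T"
      using assms(13) unfolding eq_in_distribution_def by blast+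
    \<comment> \<open>Equality in law is used through the expectation of
      \<open>exp (- t * y)\<close>; the two sides are evaluated by \<open>EMax\<close> and by
      independence.\<close>
    have "t * laplace (\<lambda>x. \<Phi> x ^ n) t = M.expectation (\<lambda>\<omega>. exp (- t * ?T \<omega>))"
      using EMax[of n t] mn t by simp
    also have "\<dots> = (\<integral>y. exp (- t * y) \<partial>distr M borel ?T)"
      using ST(2) by (subst integral_distr) auto
    also have "\<dots> = (\<integral>y. exp (- t * y) \<partial>distr M borel ?S)"
      by (simp only: ST(3))
    also have "\<dots> = M.expectation (\<lambda>\<omega>. exp (- t * ?S \<omega>))"
      using ST(1) by (subst integral_distr) auto
    also have "\<dots> = M.expectation (\<lambda>\<omega>. exp (- t * (MAX i\<in>{1..?m}. Xs i \<omega>)))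
        * (\<Prod>i=?m+1..n. M.expectation (\<lambda>\<omega>. exp (- (t * (1 / real i)) * Xs i \<omega>)))"
      using assms(11) Xnn mn t unfolding un by (intro M.expectation_exp_Max_add_sum) auto
    also have "\<dots> = t * laplace (\<lambda>x. \<Phi> x ^ ?m) t * (\<Prod>i=?m+1..n. t / real i * laplace \<Phi> (t / real i))"
    proof (intro arg_cong2[where f = "(*)"] prod.cong refl)
      show "M.expectation (\<lambda>\<omega>. exp (- t * (MAX i\<in>{1..?m}. Xs i \<omega>))) = t * laplace (\<lambda>x. \<Phi> x ^ ?m) t"
        using mn t by (intro EMax) auto
      fix i assume "i \<in> {?m + 1..n}"
      then show "M.expectation (\<lambda>\<omega>. exp (- (t * (1 / real i)) * Xs i \<omega>)) = t / real i * laplace \<Phi> (t / real i)"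
        using EX[of i "t / real i"] t by simp
    qed
    finally show ?thesis using t by simp
  qed
  have fx: "f x = f 0 * exp (- f 0 * x)" if "0 \<le> x" for x
    using assms(6,7) \<Phi>m \<Phi>b \<Phi>lim \<Phi>i mn eventually_mono[OF eventually_gt_at_top eq] that
    by (rule exponential_of_cdf_equation)
  \<comment> \<open>Both functions vanish on the negative axis, so the formula on the half line
    gives equality everywhere.\<close>
  have "exponential_density (f 0) = f"
  proof
    fix x show "exponential_density (f 0) x = f x"
    proof (cases "x < 0")
      case True
      then show ?thesis using assms(5) by (simp add: exponential_density_def)
    next
      case False
      have "exponential_density (f 0) x = f 0 * exp (- f 0 * x)"
        using False by (simp add: exponential_density_def mult.commute)
      also have "\<dots> = f x" by (rule fx[symmetric]) (use False in simp)
      finally show ?thesis .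
    qed
  qed
  then have "distributed N lborel X (\<lambda>x. ennreal (exponential_density (f 0) x))"
    using assms(3) by (simp only:)
  with fx assms(7) show ?thesis by (intro exI[of _ "f 0"] conjI allI impI)
qed

end
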